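(* Let $S$ be a finite set, let $\lambda\in FL(S)^S$, let $t$ be a scalar-valued formal variable, and let $\Lambda_t(\lambda)\in FL(S)^S$ be the (unique) solution of the ordinary differential equation $$\Lambda_0(\lambda)=0\qquad\text{and}\qquad\frac{d\Lambda_t(\lambda)}{dt}=\frac{\mathrm{ad}_{tb}\Lambda_t(\lambda)}{e^{\mathrm{ad}_{tb}\Lambda_t(\lambda)}-1}\left(e^{\partial_{\Lambda_t(\lambda)}}(\lambda)\right).$$ Then $C^{t\lambda}=e^{-\partial_{\Lambda_t(\lambda)}}$ as automorphisms of $FL(S)$.
   Context: Everything is over $\mathbb Q$. $FL(S)$ is the degree-completed free Lie algebra on the finite set $S$ of degree 1 generators, and $FL(S)^S$ is the set of functions $\lambda=(\lambda_a)_{a\in S}$ with $\lambda_a\in FL(S)$, with componentwise bracket $[\cdot,\cdot]$. For $\lambda\in FL(S)^S$, $\partial_\lambda$ is the unique (continuous) derivation of $FL(S)$ with $\partial_\lambda(a)=[a,\lambda_a]$ for every $a\in S$; it acts on $FL(S)^S$ componentwise. The tangential bracket on $FL(S)^S$ is the Lie bracket $[\lambda_1,\lambda_2]_{tb}=[\lambda_1,\lambda_2]+\partial_{\lambda_1}\lambda_2-\partial_{\lambda_2}\lambda_1$, and $\mathrm{ad}_{tb}$ is the corresponding adjoint action, $(\mathrm{ad}_{tb}\lambda_1)(\lambda_2)=[\lambda_1,\lambda_2]_{tb}$. For $\mu\in FL(S)^S$, $C^\mu$ is the automorphism of $FL(S)$ defined on generators by $C^\mu(a)=e^{\mu_a}ae^{-\mu_a}=e^{\mathrm{ad}\,\mu_a}(a)$.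 Elements depending on $t$ have, in each degree, coefficients that are power series (in fact polynomials) in $t$. *)

theory Defs
  imports "HOL-Computational_Algebra.Formal_Power_Series"
begin

unbundle fps_syntax

text \<open>
  The free Lie algebra over the rationals on the type \<^typ>\<open>'s\<close> is the algebra of Lie terms
  modulo the congruence generated by the axioms of a Lie algebra over the rationals.
\<close>

datatype 's lie_term =
    TGen 's
  | TZero
  | TAdd "'s lie_term" "'s lie_term"
  | TScale rat "'s lie_term"
  | TBr "'s lie_term" "'s lie_term"

inductive lie_cong :: "'s lie_term \<Rightarrow> 's lie_term \<Rightarrow> bool" where
  refl: "lie_cong x x"
| sym: "lie_cong x y \<Longrightarrow> lie_cong y x"
| trans: "lie_cong x y \<Longrightarrow> lie_cong y z \<Longrightarrow> lie_cong x z"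
| cong_add: "lie_cong x x' \<Longrightarrow> lie_cong y y' \<Longrightarrow> lie_cong (TAdd x y) (TAdd x' y')"
| cong_scale: "lie_cong x x' \<Longrightarrow> lie_cong (TScale c x) (TScale c x')"
| cong_br: "lie_cong x x' \<Longrightarrow> lie_cong y y' \<Longrightarrow> lie_cong (TBr x y) (TBr x' y')"
| add_assoc: "lie_cong (TAdd (TAdd x y) z) (TAdd x (TAdd y z))"
| add_comm: "lie_cong (TAdd x y) (TAdd y x)"
| add_zero: "lie_cong (TAdd TZero x) x"
| add_neg: "lie_cong (TAdd (TScale (-1) x) x) TZero"
| scale_add: "lie_cong (TScale c (TAdd x y)) (TAdd (TScale c x) (TScale c y))"
| add_scale: "lie_cong (TScale (c + d) x) (TAdd (TScale c x) (TScale d x))"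
| scale_scale: "lie_cong (TScale c (TScale d x)) (TScale (c * d) x)"
| scale_one: "lie_cong (TScale 1 x) x"
| br_add_left: "lie_cong (TBr (TAdd x y) z) (TAdd (TBr x z) (TBr y z))"
| br_add_right: "lie_cong (TBr x (TAdd y z)) (TAdd (TBr x y) (TBr x z))"
| br_scale_left: "lie_cong (TBr (TScale c x) y) (TScale c (TBr x y))"
| br_scale_right: "lie_cong (TBr x (TScale c y)) (TScale c (TBr x y))"
| br_self: "lie_cong (TBr x x) TZero"
| jacobi: "lie_cong (TAdd (TBr x (TBr y z)) (TAdd (TBr y (TBr z x)) (TBr z (TBr x y)))) TZero"

quotient_type 's free_lie = "'s lie_term" / lie_cong
  by (intro equivpI reflpI sympI transpI)
    (blast intro: lie_cong.refl lie_cong.sym lie_cong.trans)+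

lift_definition lgen :: "'s \<Rightarrow> 's free_lie" is TGen .

lift_definition lscale :: "rat \<Rightarrow> 's free_lie \<Rightarrow> 's free_lie" is TScale
  by (rule lie_cong.cong_scale)

lift_definition lbr :: "'s free_lie \<Rightarrow> 's free_lie \<Rightarrow> 's free_lie" is TBr
  by (rule lie_cong.cong_br)

instantiation free_lie :: (type) ab_group_add
begin

lift_definition zero_free_lie :: "'a free_lie" is TZero .

lift_definition plus_free_lie :: "'a free_lie \<Rightarrow> 'a free_lie \<Rightarrow> 'a free_lie" is TAdd
  by (rule lie_cong.cong_add)

lift_definition uminus_free_lie :: "'a free_lie \<Rightarrow> 'a free_lie" is "TScale (-1)"
  by (rule lie_cong.cong_scale)

lift_definition minus_free_lie :: "'a free_lie \<Rightarrow> 'a free_lie \<Rightarrow> 'a free_lie"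
  is "\<lambda>x y. TAdd x (TScale (-1) y)"
  by (intro lie_cong.cong_add lie_cong.cong_scale)

instance
proof
  fix a b c :: "'a free_lie"
  show "a + b + c = a + (b + c)" by transfer (rule lie_cong.add_assoc)
  show "a + b = b + a" by transfer (rule lie_cong.add_comm)
  show "0 + a = a" by transfer (rule lie_cong.add_zero)
  show "- a + a = 0" by transfer (rule lie_cong.add_neg)
  show "a - b = a + - b" by transfer (rule lie_cong.refl)
qed

end

inductive lhomog :: "nat \<Rightarrow> 's free_lie \<Rightarrow> bool" where
  zero: "lhomog n 0"
| gen: "lhomog 1 (lgen a)"
| add: "lhomog n x \<Longrightarrow> lhomog n y \<Longrightarrow> lhomog n (x + y)"
| scale: "lhomog n x \<Longrightarrow> lhomog n (lscale c x)"
| br: "lhomog m x \<Longrightarrow> lhomog n y \<Longrightarrow> lhomog (m + n) (lbr x y)"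

lemma lhomog_uminus: "lhomog n x \<Longrightarrow> lhomog n (- x)"
proof -
  have "- x = lscale (-1) x" by transfer (rule lie_cong.refl)
  then show "lhomog n x \<Longrightarrow> lhomog n (- x)" by (simp add: lhomog.scale)
qed

lemma lhomog_minus: "lhomog n x \<Longrightarrow> lhomog n y \<Longrightarrow> lhomog n (x - y)"
  using lhomog.add[of n x "- y"] lhomog_uminus[of n y] by simp

lemma lhomog_sum: "(\<And>i. i \<in> A \<Longrightarrow> lhomog n (f i)) \<Longrightarrow> lhomog n (sum f A)"
  by (induction A rule: infinite_finite_induct) (auto intro: lhomog.zero lhomog.add)

text \<open>The degree completion: families of homogeneous elements, one in each degree.\<close>

typedef 's FL = "{f :: nat \<Rightarrow> 's free_lie. \<forall>n. lhomog n (f n)}"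
  morphisms deg_part Abs_FL
  by (rule exI[of _ "\<lambda>_. 0"]) (simp add: lhomog.zero)

setup_lifting type_definition_FL

instantiation FL :: (type) ab_group_add
begin

lift_definition zero_FL :: "'a FL" is "\<lambda>_. 0"
  by (rule lhomog.zero)

lift_definition plus_FL :: "'a FL \<Rightarrow> 'a FL \<Rightarrow> 'a FL" is "\<lambda>f g n. f n + g n"
  by (simp add: lhomog.add)

lift_definition uminus_FL :: "'a FL \<Rightarrow> 'a FL" is "\<lambda>f n. - f n"
  by (simp add: lhomog_uminus)

lift_definition minus_FL :: "'a FL \<Rightarrow> 'a FL \<Rightarrow> 'a FL" is "\<lambda>f g n. f n - g n"
  by (simp add: lhomog_minus)

instance
  by standard (transfer; simp add: fun_eq_iff algebra_simps)+

end

lift_definition FL_gen :: "'s \<Rightarrow> 's FL" is "\<lambda>a n. if n = 1 then lgen a else 0"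
  using lhomog.gen lhomog.zero by (metis (full_types))

lift_definition FL_scale :: "rat \<Rightarrow> 's FL \<Rightarrow> 's FL" is "\<lambda>c f n. lscale c (f n)"
  by (simp add: lhomog.scale)

lift_definition FL_br :: "'s FL \<Rightarrow> 's FL \<Rightarrow> 's FL"
  is "\<lambda>f g n. \<Sum>i\<le>n. lbr (f i) (g (n - i))"
proof (intro lhomog_sum)
  fix f g :: "nat \<Rightarrow> 's free_lie" and n i :: nat
  assume "\<And>n. lhomog n (f n)" "\<And>n. lhomog n (g n)" "i \<in> {..n}"
  then show "lhomog n (lbr (f i) (g (n - i)))"
    using lhomog.br[of i "f i" "n - i" "g (n - i)"] by simp
qed

text \<open>
  Sum of a sequence that converges in the degree topology: in each degree only finitely many
  terms are nonzero.  (A degree in which infinitely many terms are nonzero gets the value 0;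
  this never happens for the series below, whose operators strictly raise the degree.)
\<close>

lift_definition FL_sum :: "(nat \<Rightarrow> 's FL) \<Rightarrow> 's FL"
  is "\<lambda>u n. \<Sum>j | u j n \<noteq> 0. u j n"
  by (simp add: lhomog_sum)

text \<open>
  The elements depending on \<open>t\<close> form \<^typ>\<open>'s FL fps\<close>: the \<open>n\<close>-th degree part of such an
  \<open>x\<close> is the power series in \<open>t\<close> with coefficients \<open>deg_part (x $ k) n\<close>.  This is the free
  Lie algebra, completed by degree, over the ground ring of power series in \<open>t\<close>; derivations
  and automorphisms of it are linear over that ring.
\<close>

definition t_scale :: "rat fps \<Rightarrow> 's FL fps \<Rightarrow> 's FL fps" where
  "t_scale p x = Abs_fps (\<lambda>k. \<Sum>i\<le>k. FL_scale (p $ i) (x $ (k - i)))"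

definition t_br :: "'s FL fps \<Rightarrow> 's FL fps \<Rightarrow> 's FL fps" where
  "t_br x y = Abs_fps (\<lambda>k. \<Sum>i\<le>k. FL_br (x $ i) (y $ (k - i)))"

definition t_deriv :: "'s FL fps \<Rightarrow> 's FL fps" where
  "t_deriv x = Abs_fps (\<lambda>k. FL_scale (of_nat (k + 1)) (x $ (k + 1)))"

definition t_sum :: "(nat \<Rightarrow> 's FL fps) \<Rightarrow> 's FL fps" where
  "t_sum u = Abs_fps (\<lambda>k. FL_sum (\<lambda>j. u j $ k))"

definition t_gen :: "'s \<Rightarrow> 's FL fps" where
  "t_gen a = fps_const (FL_gen a)"

definition vanishes_upto :: "nat \<Rightarrow> 's FL fps \<Rightarrow> bool" where
  "vanishes_upto n x \<longleftrightarrow> (\<forall>k. \<forall>i\<le>n. deg_part (x $ k) i = 0)"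

definition t_linear :: "('s FL fps \<Rightarrow> 's FL fps) \<Rightarrow> bool" where
  "t_linear f \<longleftrightarrow>
     (\<forall>x y. f (x + y) = f x + f y) \<and> (\<forall>p x. f (t_scale p x) = t_scale p (f x))"

text \<open>Continuity at 0 in the degree topology, which for additive maps is continuity.\<close>

definition deg_continuous :: "('s FL fps \<Rightarrow> 's FL fps) \<Rightarrow> bool" where
  "deg_continuous f \<longleftrightarrow> (\<forall>n. \<exists>m. \<forall>x. vanishes_upto m x \<longrightarrow> vanishes_upto n (f x))"

definition cont_derivation :: "('s FL fps \<Rightarrow> 's FL fps) \<Rightarrow> bool" where
  "cont_derivation D \<longleftrightarrow> t_linear D \<and> deg_continuous D \<and>
     (\<forall>x y. D (t_br x y) = t_br (D x) y + t_br x (D y))"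

definition cont_automorphism :: "('s FL fps \<Rightarrow> 's FL fps) \<Rightarrow> bool" where
  "cont_automorphism f \<longleftrightarrow> t_linear f \<and> deg_continuous f \<and>
     (\<forall>x y. f (t_br x y) = t_br (f x) (f y)) \<and> bij f"

definition tder :: "('s \<Rightarrow> 's FL fps) \<Rightarrow> 's FL fps \<Rightarrow> 's FL fps" where
  "tder \<mu> = (THE D. cont_derivation D \<and> (\<forall>a. D (t_gen a) = t_br (t_gen a) (\<mu> a)))"

definition ad_tb ::
  "('s \<Rightarrow> 's FL fps) \<Rightarrow> ('s \<Rightarrow> 's FL fps) \<Rightarrow> ('s \<Rightarrow> 's FL fps)" where
  "ad_tb \<mu> \<nu> = (\<lambda>a. t_br (\<mu> a) (\<nu> a) + tder \<mu> (\<nu> a) - tder \<nu> (\<mu> a))"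

text \<open>
  The value at an element (or at an \<^typ>\<open>'s\<close>-indexed family) of the power series \<open>p\<close> with
  the operator \<open>T\<close> substituted for its variable.
\<close>

definition op_series ::
  "rat fps \<Rightarrow> ('s FL fps \<Rightarrow> 's FL fps) \<Rightarrow> 's FL fps \<Rightarrow> 's FL fps" where
  "op_series p T x = t_sum (\<lambda>j. t_scale (fps_const (p $ j)) ((T ^^ j) x))"

definition op_series_fam ::
  "rat fps \<Rightarrow> (('s \<Rightarrow> 's FL fps) \<Rightarrow> ('s \<Rightarrow> 's FL fps))
     \<Rightarrow> ('s \<Rightarrow> 's FL fps) \<Rightarrow> ('s \<Rightarrow> 's FL fps)" where
  "op_series_fam p T \<nu> = (\<lambda>a. t_sum (\<lambda>j. t_scale (fps_const (p $ j)) ((T ^^ j) \<nu> a)))"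

abbreviation op_exp :: "('s FL fps \<Rightarrow> 's FL fps) \<Rightarrow> 's FL fps \<Rightarrow> 's FL fps" where
  "op_exp \<equiv> op_series (fps_exp 1)"

definition conj_aut :: "('s \<Rightarrow> 's FL fps) \<Rightarrow> 's FL fps \<Rightarrow> 's FL fps" where
  "conj_aut \<mu> =
     (THE f. cont_automorphism f \<and> (\<forall>a. f (t_gen a) = op_exp (t_br (\<mu> a)) (t_gen a)))"

definition solves_Lambda_ode :: "('s \<Rightarrow> 's FL) \<Rightarrow> ('s \<Rightarrow> 's FL fps) \<Rightarrow> bool" where
  "solves_Lambda_ode lam \<Lambda> \<longleftrightarrow>
     (\<forall>a. \<Lambda> a $ 0 = 0) \<and>
     (\<lambda>a. t_deriv (\<Lambda> a)) =
       op_series_fam (fps_X / (fps_exp 1 - 1)) (ad_tb \<Lambda>)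
         (\<lambda>a. op_exp (tder \<Lambda>) (fps_const (lam a)))"

end

theory Submission
  imports Defs
begin

text \<open>
  Write \<open>D = \<partial>\<^sub>\<Lambda>\<close> and \<open>L\<close> for the Lie algebra of elements depending on \<open>t\<close>.  Conjugating \<open>d/dt\<close> by
  \<open>e\<^sup>D\<close> gives \<open>e\<^sup>D (d/dt) e\<^sup>-\<^sup>D = \<Sum> (ad D)\<^sup>n (d/dt) / n!\<close>.  As \<open>[d/dt, \<partial>\<^sub>\<mu>] = \<partial>\<^sub>\<mu>\<^sub>'\<close> and
  \<open>\<mu> \<mapsto> \<partial>\<^sub>\<mu>\<close> turns the tangential bracket into the commutator, this is
  \<open>d/dt - \<partial>\<^sub>\<nu>\<close> with \<open>\<nu> = ((e\<^sup>z - 1) / z)(\<Lambda>')\<close> at \<open>z = ad_tb \<Lambda>\<close>, and the differential equation says exactly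
  that \<open>\<nu> = e\<^sup>D \<lambda>\<close>.  Evaluated at a generator \<open>a\<close>, the curve \<open>y = e\<^sup>-\<^sup>D a\<close> therefore satisfies
  \<open>y' = [\<lambda>\<^sub>a, y]\<close> and \<open>y(0) = a\<close>, as does \<open>e\<^bsup>ad t\<lambda>\<^sub>a\<^esup> a\<close>; such a \<open>y\<close> is unique, and a continuous
  automorphism is determined by its values on generators.  The equation for \<open>\<Lambda>\<close> has a unique
  solution because the coefficient of \<open>t\<^sup>k\<close> in its right-hand side involves only those of
  \<open>t\<^sup>0, \<dots>, t\<^sup>k\<close> in \<open>\<Lambda>\<close>.
\<close>

section \<open>Rational Lie algebras and their power series\<close>

text \<open>Three independent types let one convolution serve for products of scalar series, for
  scaling, for brackets in the degree grading or in powers of t, and for extending a map to series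
  in t.\<close>

definition cauchy :: "('a \<Rightarrow> 'b \<Rightarrow> 'c::ab_group_add) \<Rightarrow> (nat \<Rightarrow> 'a) \<Rightarrow> (nat \<Rightarrow> 'b) \<Rightarrow> nat \<Rightarrow> 'c" where
  "cauchy B f g n = (\<Sum>i\<le>n. B (f i) (g (n - i)))"

lemma sum_triangle_assoc:
  fixes f :: "nat \<Rightarrow> nat \<Rightarrow> nat \<Rightarrow> 'a::comm_monoid_add"
  shows "(\<Sum>m\<le>n. \<Sum>i\<le>m. f i (m - i) (n - m)) = (\<Sum>i\<le>n. \<Sum>j\<le>n - i. f i j (n - i - j))"
  using fps_mult_assoc_lemma[where k = n and n = n and f = f] by (simp add: atLeast0AtMost)

lemma sum_triangle_swap:
  fixes f :: "nat \<Rightarrow> nat \<Rightarrow> 'a::comm_monoid_add"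
  shows "(\<Sum>i\<le>n. \<Sum>j\<le>n - i. f i j) = (\<Sum>j\<le>n. \<Sum>i\<le>n - j. f i j)"
  by (simp add: sum.Sigma)
    (rule sum.reindex_bij_witness[of _ "\<lambda>(i, j). (j, i)" "\<lambda>(i, j). (j, i)"]; auto)

lemma sum_flip: "(\<Sum>i\<le>n. f i (n - i)) = (\<Sum>i\<le>n. f (n - i) i)" for n :: nat
  by (rule sum.reindex_bij_witness[of _ "\<lambda>i. n - i" "\<lambda>i. n - i"]) auto

lemma cauchy_assoc:
  fixes B1 :: "'a \<Rightarrow> 'b \<Rightarrow> 'c::ab_group_add" and B2 :: "'c \<Rightarrow> 'd \<Rightarrow> 'e::ab_group_add"
    and B3 :: "'b \<Rightarrow> 'd \<Rightarrow> 'f::ab_group_add" and B4 :: "'a \<Rightarrow> 'f \<Rightarrow> 'e"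
  assumes "\<And>z. additive (\<lambda>x. B2 x z)" "\<And>x. additive (B4 x)"
    and "\<And>x y z. B2 (B1 x y) z = B4 x (B3 y z)"
  shows "cauchy B2 (cauchy B1 f g) h n = cauchy B4 f (cauchy B3 g h) n"
  by (simp add: cauchy_def additive.sum[OF assms(1)] additive.sum[OF assms(2)] assms(3)
      sum_triangle_assoc[of "\<lambda>i j k. B4 (f i) (B3 (g j) (h k))"])

text \<open>Antisymmetry takes the place of \<open>B x x = 0\<close> because it passes to
  convolutions term by term; over the rationals, halving recovers \<open>B_self\<close>. The Jacobi
  identity is written so as to say that \<open>B x\<close> is a derivation.\<close>

locale rat_lie = vector_space s for s :: "rat \<Rightarrow> 'v::ab_group_add \<Rightarrow> 'v" +
  fixes B :: "'v \<Rightarrow> 'v \<Rightarrow> 'v"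
  assumes B_add_left: "B (x + y) z = B x z + B y z"
    and B_scale_left: "B (s c x) y = s c (B x y)"
    and B_anti: "B x y = - B y x"
    and B_jacobi: "B x (B y z) = B (B x y) z + B y (B x z)"
begin

lemma B_add_right: "B x (y + z) = B x y + B x z"
  using B_add_left[of y z x] by (simp add: B_anti[of x])

lemma B_scale_right: "B x (s c y) = s c (B x y)"
  using B_scale_left[of c y x] by (simp add: B_anti[of x])

lemma eq_uminus_self_zero: "x = - x \<Longrightarrow> x = 0" for x :: 'v
proof -
  assume "x = - x"
  then have "s 1 x + s 1 x = 0" by (metis add.right_inverse scale_one)
  then have "s (1/2) (s (1 + 1) x) = 0"
    by (metis scale_left_distrib scale_zero_right)
  then show "x = 0" by simp
qed

lemma B_self: "B x x = 0"
  by (rule eq_uminus_self_zero) (rule B_anti)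

lemma additive_B_left: "additive (\<lambda>x. B x z)"
  by (standard) (rule B_add_left)

lemma additive_B_right: "additive (B z)"
  by (standard) (rule B_add_right)

lemmas B_sum_left = additive.sum[OF additive_B_left]
lemmas B_sum_right = additive.sum[OF additive_B_right]

lemma cauchy_anti: "cauchy B f g n = - cauchy B g f n"
  unfolding cauchy_def sum_flip[of "\<lambda>i j. B (f i) (g j)"] sum_negf[symmetric]
  by (rule sum.cong[OF HOL.refl]) (rule B_anti)

lemma cauchy_jacobi:
  "cauchy B f (cauchy B g h) n = cauchy B (cauchy B f g) h n + cauchy B g (cauchy B f h) n"
proof -
  have "cauchy B f (cauchy B g h) n
      = (\<Sum>i\<le>n. \<Sum>j\<le>n - i. B (B (f i) (g j)) (h (n - i - j)))
        + (\<Sum>i\<le>n. \<Sum>j\<le>n - i. B (g j) (B (f i) (h (n - i - j))))"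
    unfolding cauchy_def B_sum_right sum.distrib[symmetric] by (simp only: B_jacobi[symmetric])
  also have "(\<Sum>i\<le>n. \<Sum>j\<le>n - i. B (B (f i) (g j)) (h (n - i - j))) = cauchy B (cauchy B f g) h n"
    by (simp add: cauchy_def B_sum_left sum_triangle_assoc[of "\<lambda>i j k. B (B (f i) (g j)) (h k)"])
  also have "(\<Sum>i\<le>n. \<Sum>j\<le>n - i. B (g j) (B (f i) (h (n - i - j)))) = cauchy B g (cauchy B f h) n"
    unfolding cauchy_def B_sum_right by (subst sum_triangle_swap) (simp add: add.commute)
  finally show ?thesis .
qed

text \<open>The axioms are checked on coefficients, where they are inherited by convolution. This
  serves the degree completion (\<open>coef\<close> is \<open>deg_part\<close>) as well as power
  series (\<open>coef\<close> is \<open>fps_nth\<close>).\<close>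

lemma rat_lie_cauchy:
  fixes coef :: "'w::ab_group_add \<Rightarrow> nat \<Rightarrow> 'v"
  assumes inj: "\<And>x y. (\<And>n. coef x n = coef y n) \<Longrightarrow> x = y"
    and add: "\<And>x y n. coef (x + y) n = coef x n + coef y n"
    and scale: "\<And>c x n. coef (s' c x) n = s c (coef x n)"
    and br: "\<And>x y n. coef (B' x y) n = cauchy B (coef x) (coef y) n"
  shows "rat_lie s' B'"
proof -
  have um: "coef (- x) n = - coef x n" for x n
    by (rule additive.minus) (simp add: additive_def add)
  have br': "coef (B' x y) = cauchy B (coef x) (coef y)" for x y
    using br by blast
  show ?thesis
  proof (unfold_locales; rule inj)
    fix c d x y z n
    show "coef (s' c (x + y)) n = coef (s' c x + s' c y) n"
      by (simp add: add scale scale_right_distrib)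
    show "coef (s' (c + d) x) n = coef (s' c x + s' d x) n"
      by (simp add: add scale scale_left_distrib)
    show "coef (s' c (s' d x)) n = coef (s' (c * d) x) n" "coef (s' 1 x) n = coef x n"
      by (simp_all add: scale)
    show "coef (B' (x + y) z) n = coef (B' x z + B' y z) n"
      by (simp add: add br cauchy_def B_add_left sum.distrib)
    show "coef (B' (s' c x) y) n = coef (s' c (B' x y)) n"
      by (simp add: scale br cauchy_def B_scale_left scale_sum_right)
    show "coef (B' x y) n = coef (- B' y x) n"
      unfolding um br by (rule cauchy_anti)
    show "coef (B' x (B' y z)) n = coef (B' (B' x y) z + B' y (B' x z)) n"
      unfolding add br br' by (rule cauchy_jacobi)
  qed
qed

section \<open>Universal property of the free Lie algebra\<close>

primrec term_eval :: "('s \<Rightarrow> 'v) \<Rightarrow> 's lie_term \<Rightarrow> 'v" where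
  "term_eval g (TGen a) = g a"
| "term_eval g TZero = 0"
| "term_eval g (TAdd x y) = term_eval g x + term_eval g y"
| "term_eval g (TScale c x) = s c (term_eval g x)"
| "term_eval g (TBr x y) = B (term_eval g x) (term_eval g y)"

lemma term_eval_cong: "lie_cong x y \<Longrightarrow> term_eval g x = term_eval g y"
proof (induction rule: lie_cong.induct)
  case (jacobi x y z)
  define X Y Z where "X = term_eval g x" "Y = term_eval g y" "Z = term_eval g z"
  have "B X (B Y Z) + (B Y (B Z X) + B Z (B X Y)) = 0"
    using B_jacobi[of X Y Z] B_anti[of Z X] B_anti[of Z "B X Y"]
    by (simp add: additive.minus[OF additive_B_right])
  then show ?case by (simp add: X_Y_Z_def)
qed (simp_all add: scale_left_distrib scale_right_distrib B_add_left B_add_right B_scale_left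
      B_scale_right B_self)

text \<open>Every rule of \<open>lie_cong\<close> holds in a rational Lie algebra, so the value of a
  term does not depend on the representative chosen by \<open>rep_free_lie\<close>.\<close>

lemma free_lie_extension:
  fixes g :: "'s \<Rightarrow> 'v"
  obtains h :: "'s free_lie \<Rightarrow> 'v" where "\<And>a. h (lgen a) = g a"
    and "\<And>x y. h (x + y) = h x + h y" "\<And>c x. h (lscale c x) = s c (h x)"
    and "\<And>x y. h (lbr x y) = B (h x) (h y)"
proof -
  define h where "h x = term_eval g (rep_free_lie x)" for x
  have h: "h (abs_free_lie t) = term_eval g t" for t
    unfolding h_def
    by (rule term_eval_cong, rule Quotient3_rep_abs[OF Quotient3_free_lie]) (rule lie_cong.refl)
  have ex: "\<exists>t. x = abs_free_lie t" for x :: "'s free_lie"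
    by (metis Quotient3_abs_rep Quotient3_free_lie)
  show ?thesis
  proof (rule that[of h])
    show "h (lgen a) = g a" for a by (simp add: lgen.abs_eq h)
    show "h (x + y) = h x + h y" for x y
      using ex[of x] ex[of y] by (auto simp: plus_free_lie.abs_eq h)
    show "h (lscale c x) = s c (h x)" for c x
      using ex[of x] by (auto simp: lscale.abs_eq h)
    show "h (lbr x y) = B (h x) (h y)" for x y
      using ex[of x] ex[of y] by (auto simp: lbr.abs_eq h)
  qed
qed

end

section \<open>Lie structure on the free Lie algebra, on its completion and on series in t\<close>

interpretation free: rat_lie lscale "lbr :: 's free_lie \<Rightarrow> _"
proof
  fix c d :: rat and x y z :: "'s free_lie"
  show "lscale c (x + y) = lscale c x + lscale c y" by transfer (rule lie_cong.scale_add)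
  show "lscale (c + d) x = lscale c x + lscale d x" by transfer (rule lie_cong.add_scale)
  show "lscale c (lscale d x) = lscale (c * d) x" by transfer (rule lie_cong.scale_scale)
  show "lscale 1 x = x" by transfer (rule lie_cong.scale_one)
  have addl: "lbr (x + y) z = lbr x z + lbr y z" for x y z :: "'s free_lie"
    by transfer (rule lie_cong.br_add_left)
  then show "lbr (x + y) z = lbr x z + lbr y z" .
  have addr: "lbr z (x + y) = lbr z x + lbr z y" for x y z :: "'s free_lie"
    by transfer (rule lie_cong.br_add_right)
  have self: "lbr x x = 0" for x :: "'s free_lie" by transfer (rule lie_cong.br_self)
  show "lbr (lscale c x) y = lscale c (lbr x y)" by transfer (rule lie_cong.br_scale_left)
  have anti: "lbr x y = - lbr y x" for x y :: "'s free_lie"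
    using self[of "x + y"] self[of x] self[of y]
    by (simp add: addl addr eq_neg_iff_add_eq_0 add.commute)
  then show "lbr x y = - lbr y x" .
  have "lbr x (lbr y z) + (lbr y (lbr z x) + lbr z (lbr x y)) = 0"
    by transfer (rule lie_cong.jacobi)
  moreover have "lbr y (lbr z x) = - lbr y (lbr x z)"
    unfolding anti[of z x] by (rule additive.minus) (simp add: additive_def addr)
  ultimately show "lbr x (lbr y z) = lbr (lbr x y) z + lbr y (lbr x z)"
    using anti[of z "lbr x y"] by (simp add: algebra_simps eq_neg_iff_add_eq_0)
qed

interpretation FL: rat_lie FL_scale "FL_br :: 's FL \<Rightarrow> _"
proof (rule free.rat_lie_cauchy[of deg_part])
  fix x y :: "'s FL" and c n
  show "(\<And>n. deg_part x n = deg_part y n) \<Longrightarrow> x = y"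
    by (simp add: deg_part_inject[symmetric] fun_eq_iff)
  show "deg_part (x + y) n = deg_part x n + deg_part y n" by (simp add: plus_FL.rep_eq)
  show "deg_part (FL_scale c x) n = lscale c (deg_part x n)" by (simp add: FL_scale.rep_eq)
  show "deg_part (FL_br x y) n = cauchy lbr (deg_part x) (deg_part y) n"
    by (simp add: FL_br.rep_eq cauchy_def)
qed

text \<open>Generic because series are formed twice: in t over \<open>FL\<close>, and in an
  auxiliary variable over the resulting algebra in \<open>free_lie_derivation\<close>.\<close>

definition fps_scale :: "('r \<Rightarrow> 'v \<Rightarrow> 'v) \<Rightarrow> 'r \<Rightarrow> 'v fps \<Rightarrow> 'v fps" where
  "fps_scale s c x = Abs_fps (\<lambda>k. s c (x $ k))"

definition fps_br :: "('v \<Rightarrow> 'v \<Rightarrow> 'v::ab_group_add) \<Rightarrow> 'v fps \<Rightarrow> 'v fps \<Rightarrow> 'v fps" where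
  "fps_br B x y = Abs_fps (cauchy B (fps_nth x) (fps_nth y))"

lemma (in rat_lie) rat_lie_fps: "rat_lie (fps_scale s) (fps_br B)"
  by (rule rat_lie_cauchy[of fps_nth]) (simp_all add: fps_scale_def fps_br_def fps_eq_iff)

lemma t_scale_nth: "t_scale p x $ k = cauchy FL_scale (fps_nth p) (fps_nth x) k"
  by (simp add: t_scale_def cauchy_def)

lemma t_br_nth: "t_br x y $ k = cauchy FL_br (fps_nth x) (fps_nth y) k"
  by (simp add: t_br_def cauchy_def)

lemma t_scale_const_nth [simp]: "t_scale (fps_const c) x $ k = FL_scale c (x $ k)"
proof -
  have "t_scale (fps_const c) x $ k = (\<Sum>i\<le>k. if i = 0 then FL_scale c (x $ k) else 0)"
    unfolding t_scale_def fps_nth_Abs_fps by (rule sum.cong) auto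
  then show ?thesis by simp
qed

text \<open>\<open>L\<close> has rational scalars only; linearity over the ring of series in t comes
  from \<open>T\<close>, \<open>t_br_scale_left\<close> and \<open>t_br_scale_right\<close>.\<close>

interpretation L: rat_lie "\<lambda>c. t_scale (fps_const c)" "t_br :: 's FL fps \<Rightarrow> _"
proof -
  have s: "(\<lambda>c. t_scale (fps_const c) :: 's FL fps \<Rightarrow> _) = fps_scale FL_scale"
    by (simp add: fun_eq_iff fps_scale_def fps_eq_iff)
  have b: "t_br = (fps_br FL_br :: 's FL fps \<Rightarrow> _)"
    by (simp add: fun_eq_iff fps_br_def t_br_nth fps_eq_iff)
  show "rat_lie (\<lambda>c. t_scale (fps_const c)) (t_br :: 's FL fps \<Rightarrow> _)"
    unfolding s b by (rule FL.rat_lie_fps)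
qed

interpretation T: module "t_scale :: rat fps \<Rightarrow> 's FL fps \<Rightarrow> _"
proof
  fix p q :: "rat fps" and x y :: "'s FL fps"
  show "t_scale p (x + y) = t_scale p x + t_scale p y"
    by (simp add: fps_eq_iff t_scale_nth cauchy_def FL.scale_right_distrib sum.distrib)
  show "t_scale (p + q) x = t_scale p x + t_scale q x"
    by (simp add: fps_eq_iff t_scale_nth cauchy_def FL.scale_left_distrib sum.distrib)
  have "fps_nth (p * q) = cauchy (*) (fps_nth p) (fps_nth q)"
    by (simp add: fun_eq_iff fps_mult_nth cauchy_def atLeast0AtMost)
  moreover have "fps_nth (t_scale q x) = cauchy FL_scale (fps_nth q) (fps_nth x)"
    by (simp add: fun_eq_iff t_scale_nth)
  ultimately show "t_scale p (t_scale q x) = t_scale (p * q) x"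
    unfolding fps_eq_iff t_scale_nth
    by (simp, intro allI cauchy_assoc[symmetric])
      (simp_all add: additive_def FL.scale_left_distrib FL.scale_right_distrib)
  show "t_scale 1 x = x"
    using t_scale_const_nth[of 1 x] unfolding fps_const_1_eq_1 by (simp add: fps_eq_iff)
qed

lemma t_br_scale_left: "t_br (t_scale p x) y = t_scale p (t_br x y)"
proof -
  have "fps_nth (t_scale p x) = cauchy FL_scale (fps_nth p) (fps_nth x)"
    and "fps_nth (t_br x y) = cauchy FL_br (fps_nth x) (fps_nth y)"
    by (simp_all add: fun_eq_iff t_scale_nth t_br_nth)
  then show ?thesis
    unfolding fps_eq_iff t_scale_nth t_br_nth
    by (simp, intro allI cauchy_assoc)
      (simp_all add: additive_def FL.B_add_left FL.scale_right_distrib FL.B_scale_left)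
qed

lemma t_br_scale_right: "t_br x (t_scale p y) = t_scale p (t_br x y)"
  using t_br_scale_left[of p y x] by (simp add: L.B_anti[of x])

section \<open>The degree filtration and convergent sums\<close>

lemma cauchy_leibniz:
  fixes B :: "'a \<Rightarrow> 'b \<Rightarrow> 's FL"
  assumes "\<And>c x y. B (s1 c x) y = FL_scale c (B x y)" "\<And>c x y. B x (s2 c y) = FL_scale c (B x y)"
  shows "FL_scale (of_nat (k + 1)) (cauchy B f g (k + 1)) =
    cauchy B (\<lambda>i. s1 (of_nat (i + 1)) (f (i + 1))) g k
    + cauchy B f (\<lambda>i. s2 (of_nat (i + 1)) (g (i + 1))) k"
proof -
  let ?w = "\<lambda>i. B (f i) (g (Suc k - i))"
  \<comment> \<open>On the i-th term the factor k + 1 splits as i + (k + 1 - i). The term i = 0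
    drops out of the first sum and i = k + 1 out of the second, which leaves two convolutions of
    index k.\<close>
  have "FL_scale (of_nat (k + 1)) (cauchy B f g (k + 1))
      = (\<Sum>i\<le>Suc k. FL_scale (of_nat i) (?w i) + FL_scale (of_nat (Suc k - i)) (?w i))"
    unfolding cauchy_def FL.scale_sum_right FL.scale_left_distrib[symmetric] of_nat_add[symmetric]
    by (rule sum.cong) auto
  also have "\<dots> = (\<Sum>i\<le>Suc k. FL_scale (of_nat i) (?w i))
      + (\<Sum>i\<le>Suc k. FL_scale (of_nat (Suc k - i)) (?w i))"
    by (rule sum.distrib)
  also have "(\<Sum>i\<le>Suc k. FL_scale (of_nat i) (?w i))
      = cauchy B (\<lambda>i. s1 (of_nat (i + 1)) (f (i + 1))) g k"
    unfolding cauchy_def assms sum.atMost_Suc_shift by simp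
  also have "(\<Sum>i\<le>Suc k. FL_scale (of_nat (Suc k - i)) (?w i))
      = cauchy B f (\<lambda>i. s2 (of_nat (i + 1)) (g (i + 1))) k"
    unfolding cauchy_def assms sum.atMost_Suc by (simp add: Suc_diff_le)
  finally show ?thesis .
qed

lemma t_deriv_nth: "t_deriv x $ k = FL_scale (of_nat (k + 1)) (x $ (k + 1))"
  by (simp add: t_deriv_def)

lemma t_deriv_add: "t_deriv (x + y) = t_deriv x + t_deriv y"
  by (simp add: fps_eq_iff t_deriv_nth FL.scale_right_distrib)

lemma t_deriv_br: "t_deriv (t_br x y) = t_br (t_deriv x) y + t_br x (t_deriv y)"
  unfolding fps_eq_iff fps_add_nth t_deriv_nth t_br_nth
  by (intro allI cauchy_leibniz FL.B_scale_left FL.B_scale_right)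

lemma t_deriv_scale:
  "t_deriv (t_scale p x) = t_scale (fps_deriv p) x + t_scale p (t_deriv x)"
proof -
  have "fps_nth (fps_deriv p) = (\<lambda>i. of_nat (i + 1) * p $ (i + 1))"
    by (simp add: fun_eq_iff)
  then show ?thesis
    unfolding fps_eq_iff fps_add_nth t_deriv_nth t_scale_nth
    by (simp only:, intro allI cauchy_leibniz) (simp_all add: mult.commute)
qed

lemma t_deriv_const [simp]: "t_deriv (fps_const x) = 0"
  by (simp add: fps_eq_iff t_deriv_nth)

lemma t_deriv_gen [simp]: "t_deriv (t_gen a) = 0"
  by (simp add: t_gen_def)

section \<open>The degree filtration\<close>

definition low :: "nat \<Rightarrow> 's FL fps \<Rightarrow> bool" where
  "low N x \<longleftrightarrow> (\<forall>k. \<forall>i<N. deg_part (x $ k) i = 0)"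

text \<open>The strict bound in \<open>low\<close> makes levels add up under brackets and makes
  level 0 the whole algebra.\<close>

lemma vanishes_upto_low: "vanishes_upto n x \<longleftrightarrow> low (Suc n) x"
  by (simp add: vanishes_upto_def low_def less_Suc_eq_le)

text \<open>Generators have degree 1 and brackets add degrees, so degree 0 is empty. Hence every
  element has level 1, which is why bracketing and tangential derivations raise the level.\<close>

lemma lhomog_0: "lhomog n x \<Longrightarrow> n = 0 \<Longrightarrow> x = 0"
proof (induction rule: lhomog.induct)
  case (br m x n y)
  then show ?case using free.B_scale_left[of 0 0 y] by simp
qed auto

lemma lhomog_deg_part: "lhomog n (deg_part x n)"
  using deg_part[of x] by simp

lemma deg_part_0 [simp]: "deg_part x 0 = 0"
  using lhomog_0[OF lhomog_deg_part HOL.refl] .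

lemma FL_eqI: "(\<And>n. deg_part x n = deg_part y n) \<Longrightarrow> x = y"
  by (simp add: deg_part_inject[symmetric] fun_eq_iff)

lemma additive_deg_part: "additive (\<lambda>x. deg_part x i)"
  by standard (simp add: plus_FL.rep_eq)

lemmas deg_part_sum = additive.sum[OF additive_deg_part]

lemma low_0 [simp]: "low n 0"
  by (simp add: low_def zero_FL.rep_eq)

lemma low_1 [simp]: "low (Suc 0) x"
  by (simp add: low_def)

lemma low_zero [simp]: "low 0 x"
  by (simp add: low_def)

lemma low_mono: "low n x \<Longrightarrow> m \<le> n \<Longrightarrow> low m x"
  by (simp add: low_def)

lemma low_add: "low n x \<Longrightarrow> low n y \<Longrightarrow> low n (x + y)"
  by (simp add: low_def plus_FL.rep_eq)

lemma low_diff: "low n x \<Longrightarrow> low n y \<Longrightarrow> low n (x - y)"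
  by (simp add: low_def minus_FL.rep_eq)

lemma low_uminus: "low n x \<Longrightarrow> low n (- x)"
  by (simp add: low_def uminus_FL.rep_eq)

lemma low_sum: "(\<And>i. i \<in> A \<Longrightarrow> low n (f i)) \<Longrightarrow> low n (sum f A)"
  by (induction A rule: infinite_finite_induct) (auto intro: low_add)

lemma low_scale: "low n x \<Longrightarrow> low n (t_scale p x)"
  by (simp add: low_def t_scale_def deg_part_sum FL_scale.rep_eq)

lemma low_deriv: "low n x \<Longrightarrow> low n (t_deriv x)"
  by (simp add: low_def t_deriv_nth FL_scale.rep_eq)

lemma low_br:
  assumes "low m x" "low n y" shows "low (m + n) (t_br x y)"
  unfolding low_def
proof (intro allI impI)
  fix k i assume i: "i < m + n"
  have "lbr (deg_part (x $ j) l) (deg_part (y $ (k - j)) (i - l)) = 0" for j l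
  proof (cases "l < m")
    case True
    then have "deg_part (x $ j) l = 0" using assms(1) by (simp add: low_def)
    then show ?thesis using free.additive_B_left additive.zero by metis
  next
    case False
    then have "deg_part (y $ (k - j)) (i - l) = 0" using assms(2) i by (cases "n = 0") (simp_all add: low_def)
    then show ?thesis using free.additive_B_right additive.zero by metis
  qed
  then show "deg_part (t_br x y $ k) i = 0"
    by (simp add: t_br_def deg_part_sum FL_br.rep_eq)
qed

lemma low_br_right: "low n y \<Longrightarrow> low (Suc n) (t_br x y)"
  using low_br[of "Suc 0" x n y] by simp

text \<open>The filtration is separated; identities between infinite sums are proved modulo every
  level.\<close>

lemma low_eq_0: "(\<And>n. low n x) \<Longrightarrow> x = 0"
  by (metis FL_eqI fps_ext fps_zero_nth lessI low_def zero_FL.rep_eq)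

lemma low_eqI: "(\<And>n. low n (x - y)) \<Longrightarrow> x = y"
  using low_eq_0[of "x - y"] by simp

lemma low_diff_trans [trans]: "low n (x - y) \<Longrightarrow> low n (y - z) \<Longrightarrow> low n (x - z)"
  using low_add[of n "x - y" "y - z"] by simp

section \<open>Convergent sums\<close>

lemma t_sum_approx:
  assumes "\<And>j. low j (u j)"
  shows "low n (t_sum u - (\<Sum>j<n. u j))"
  unfolding low_def
proof (intro allI impI)
  fix k i assume i: "i < n"
  \<comment> \<open>Terms of index above i vanish in degree i, so the support over which
    \<open>FL_sum\<close> adds is finite and lies below n; the default value for infinite support
    does not occur.\<close>
  have z: "deg_part (u j $ k) i = 0" if "j > i" for j
    using assms[of j] that by (simp add: low_def)
  have "{j. deg_part (u j $ k) i \<noteq> 0} \<subseteq> {..<n}"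
  proof
    fix j assume "j \<in> {j. deg_part (u j $ k) i \<noteq> 0}"
    then have "\<not> i < j" using z[of j] by auto
    then show "j \<in> {..<n}" using i by simp
  qed
  then have "(\<Sum>j | deg_part (u j $ k) i \<noteq> 0. deg_part (u j $ k) i) = (\<Sum>j<n. deg_part (u j $ k) i)"
    by (intro sum.mono_neutral_left) auto
  then show "deg_part ((t_sum u - (\<Sum>j<n. u j)) $ k) i = 0"
    by (simp add: t_sum_def FL_sum.rep_eq minus_FL.rep_eq fps_sum_nth deg_part_sum)
qed

lemma t_sum_eqI:
  assumes "\<And>j. low j (u j)" "\<And>n. low n (x - (\<Sum>j<n. u j))"
  shows "x = t_sum u"
proof (rule low_eqI)
  fix n
  show "low n (x - t_sum u)"
    using low_diff[OF assms(2)[of n] t_sum_approx[where u = u and n = n, OF assms(1)]] by simp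
qed

lemma low_t_sum:
  assumes "\<And>j. low j (u j)" "\<And>j. low m (u j)" shows "low m (t_sum u)"
  using low_add[OF t_sum_approx[where u = u and n = m, OF assms(1)] low_sum[where f = u and A = "{..<m}", OF assms(2)]]
  by simp

text \<open>Stated for maps of families so as to cover both operators on the algebra (through an
  evaluation) and operators on families.\<close>

lemma additive_t_sum_fam:
  fixes G :: "('i \<Rightarrow> 's FL fps) \<Rightarrow> 's FL fps"
  assumes add: "\<And>\<mu> \<nu>. G (\<lambda>a. \<mu> a + \<nu> a) = G \<mu> + G \<nu>"
    and lowG: "\<And>n \<mu>. (\<And>a. low n (\<mu> a)) \<Longrightarrow> low n (G \<mu>)"
    and u: "\<And>j a. low j (u j a)"
  shows "G (\<lambda>a. t_sum (\<lambda>j. u j a)) = t_sum (\<lambda>j. G (u j))"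
proof (rule t_sum_eqI)
  show "low j (G (u j))" for j by (rule lowG) (rule u)
  fix n
  have diff: "G (\<lambda>a. \<mu> a - \<nu> a) = G \<mu> - G \<nu>" for \<mu> \<nu>
    using add[of "\<lambda>a. \<mu> a - \<nu> a" \<nu>] by simp
  have "G (\<lambda>a. \<Sum>j\<in>A. u j a) = (\<Sum>j\<in>A. G (u j))" if "finite A" for A
    using that by (induction A) (use diff[of "\<lambda>_. 0" "\<lambda>_. 0"] in \<open>simp_all add: add\<close>)
  then have "G (\<lambda>a. t_sum (\<lambda>j. u j a)) - (\<Sum>j<n. G (u j))
      = G (\<lambda>a. t_sum (\<lambda>j. u j a) - (\<Sum>j<n. u j a))"
    by (simp add: diff)
  also have "low n \<dots>"
    by (intro lowG t_sum_approx u)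
  finally show "low n (G (\<lambda>a. t_sum (\<lambda>j. u j a)) - (\<Sum>j<n. G (u j)))" .
qed

lemma additive_t_sum:
  fixes F :: "'s FL fps \<Rightarrow> 's FL fps"
  assumes "\<And>x y. F (x + y) = F x + F y" "\<And>n x. low n x \<Longrightarrow> low n (F x)" "\<And>j. low j (u j)"
  shows "F (t_sum u) = t_sum (\<lambda>j. F (u j))"
  \<comment> \<open>A single element is a family indexed by the one-point type.\<close>
  by (rule additive_t_sum_fam[of "\<lambda>\<mu>. F (\<mu> ())" "\<lambda>j _. u j"]) (use assms in auto)

lemma t_sum_add:
  assumes "\<And>j. low j (u j)" "\<And>j. low j (v j)"
  shows "t_sum (\<lambda>j. u j + v j) = t_sum u + t_sum v"
  \<comment> \<open>Addition is viewed as an additive map on families indexed by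
    \<open>bool\<close>.\<close>
  using additive_t_sum_fam[of "\<lambda>\<mu>. \<mu> True + \<mu> False" "\<lambda>j b. if b then u j else v j"] assms
  by (simp add: low_add algebra_simps)

lemma t_sum_zero [simp]: "t_sum (\<lambda>j. 0) = 0"
  by (rule t_sum_eqI[symmetric]) simp_all

lemma t_sum_shift:
  assumes "\<And>j. low j (u j)"
  shows "t_sum u = u 0 + t_sum (\<lambda>j. u (Suc j))"
proof (rule low_eqI)
  fix n
  have s: "low j (u (Suc j))" for j using assms low_mono by (metis le_SucI order_refl)
  have "low n (t_sum u - (\<Sum>j<Suc n. u j))"
    using t_sum_approx[OF assms, of "Suc n"] low_mono le_SucI order_refl by metis
  from low_diff[OF this t_sum_approx[where u = "\<lambda>j. u (Suc j)", OF s]]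
  have "low n (t_sum u - (\<Sum>j<Suc n. u j) - (t_sum (\<lambda>j. u (Suc j)) - (\<Sum>j<n. u (Suc j))))" .
  also have "t_sum u - (\<Sum>j<Suc n. u j) - (t_sum (\<lambda>j. u (Suc j)) - (\<Sum>j<n. u (Suc j)))
      = t_sum u - (u 0 + t_sum (\<lambda>j. u (Suc j)))"
    unfolding sum.lessThan_Suc_shift by simp
  finally show "low n (t_sum u - (u 0 + t_sum (\<lambda>j. u (Suc j))))" .
qed

text \<open>Modulo level n both sides are finite sums, one over the square i, j < n and one over the
  triangle i + j < n; the terms in which they differ have i + j at least n.\<close>

lemma t_sum_t_sum:
  assumes w: "\<And>i j. low (i + j) (w i j)"
  shows "t_sum (\<lambda>i. t_sum (w i)) = t_sum (\<lambda>n. \<Sum>i\<le>n. w i (n - i))"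
proof (rule t_sum_eqI)
  have wj: "low j (w i j)" for i j by (rule low_mono[OF w]) simp
  have inner: "low n (\<Sum>i\<le>n. w i (n - i))" for n
    using w by (intro low_sum) (metis atMost_iff le_add_diff_inverse)
  show "low n (\<Sum>i\<le>n. w i (n - i))" for n by (rule inner)
  fix n
  have "low n (t_sum (\<lambda>i. t_sum (w i)) - (\<Sum>i<n. t_sum (w i)))"
    by (intro t_sum_approx low_t_sum wj low_mono[OF w]) simp
  also have "low n ((\<Sum>i<n. t_sum (w i)) - (\<Sum>i<n. \<Sum>j<n. w i j))"
    unfolding sum_subtractf[symmetric] by (intro low_sum t_sum_approx wj)
  also have "low n ((\<Sum>i<n. \<Sum>j<n. w i j) - (\<Sum>m<n. \<Sum>i\<le>m. w i (m - i)))"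
  proof -
    let ?T = "{(i, j). i + j < n}"
    have sub: "?T \<subseteq> {..<n} \<times> {..<n}" by auto
    have "(\<Sum>i<n. \<Sum>j<n. w i j) - (\<Sum>(i, j)\<in>?T. w i j)
        = (\<Sum>(i, j)\<in>{..<n} \<times> {..<n} - ?T. w i j)"
      unfolding sum.cartesian_product
      using sub by (subst sum_diff) auto
    moreover have "low n \<dots>"
      by (intro low_sum) (auto intro: low_mono[OF w])
    ultimately show ?thesis by (simp add: sum.triangle_reindex)
  qed
  finally show "low n (t_sum (\<lambda>i. t_sum (w i)) - (\<Sum>m<n. \<Sum>i\<le>m. w i (m - i)))" .
qed

lemma t_br_t_sum:
  assumes u: "\<And>i. low i (u i)" and v: "\<And>j. low j (v j)"
  shows "t_br (t_sum u) (t_sum v) = t_sum (\<lambda>n. \<Sum>i\<le>n. t_br (u i) (v (n - i)))"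
proof -
  have "t_br (t_sum u) (t_sum v) = t_sum (\<lambda>i. t_br (u i) (t_sum v))"
    using low_br[where n = 0] by (intro additive_t_sum L.B_add_left u) simp
  also have "\<dots> = t_sum (\<lambda>i. t_sum (\<lambda>j. t_br (u i) (v j)))"
    using low_br[where m = 0]
    by (intro arg_cong[where f = t_sum] ext additive_t_sum L.B_add_right v) simp
  also have "\<dots> = t_sum (\<lambda>n. \<Sum>i\<le>n. t_br (u i) (v (n - i)))"
    by (intro t_sum_t_sum low_br u v)
  finally show ?thesis .
qed

lemma t_linearD:
  assumes "t_linear f"
  shows "f (x + y) = f x + f y" "f (t_scale p x) = t_scale p (f x)" "f 0 = 0" "f (- x) = - f x"
    "f (x - y) = f x - f y" "f (sum g A) = (\<Sum>i\<in>A. f (g i))"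
proof -
  have a: "additive f" using assms by (simp add: t_linear_def additive_def)
  show "f (x + y) = f x + f y" "f (t_scale p x) = t_scale p (f x)"
    using assms by (simp_all add: t_linear_def)
  show "f 0 = 0" "f (- x) = - f x" "f (x - y) = f x - f y" "f (sum g A) = (\<Sum>i\<in>A. f (g i))"
    using a by (rule additive.zero additive.minus additive.diff additive.sum)+
qed

section \<open>Tangential derivations\<close>

definition t_single :: "nat \<Rightarrow> 's free_lie \<Rightarrow> 's FL fps" where
  "t_single n x = fps_const (Abs_FL (\<lambda>m. if m = n then x else 0))"

text \<open>\<open>Abs_FL\<close> in \<open>t_single\<close> is meaningful only for an element
  homogeneous of the stated degree, whence the homogeneity hypotheses from here on.\<close>

lemma deg_part_t_single:
  assumes "lhomog n x"
  shows "deg_part (t_single n x $ k) m = (if k = 0 \<and> m = n then x else 0)"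
  using assms by (simp add: t_single_def Abs_FL_inverse lhomog.zero zero_FL.rep_eq)

lemma t_eqI: "(\<And>k n. deg_part (x $ k) n = deg_part (y $ k) n) \<Longrightarrow> x = y"
  by (intro fps_ext FL_eqI)

lemma t_single_zero: "t_single n 0 = 0"
  by (rule t_eqI) (simp add: deg_part_t_single lhomog.zero zero_FL.rep_eq)

lemma t_single_gen: "t_single 1 (lgen a) = t_gen a"
  using lhomog.gen[of a]
  by (intro t_eqI) (simp add: deg_part_t_single t_gen_def FL_gen.rep_eq zero_FL.rep_eq)

lemma t_single_add:
  assumes "lhomog n x" "lhomog n y" shows "t_single n (x + y) = t_single n x + t_single n y"
  using assms by (intro t_eqI) (simp add: deg_part_t_single lhomog.add plus_FL.rep_eq)

lemma t_single_scale:
  assumes "lhomog n x" shows "t_single n (lscale c x) = t_scale (fps_const c) (t_single n x)"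
  using assms by (intro t_eqI) (simp add: deg_part_t_single lhomog.scale FL_scale.rep_eq)

lemma lbr_zero [simp]: "lbr 0 x = 0" "lbr x 0 = 0"
  using additive.zero[OF free.additive_B_left] additive.zero[OF free.additive_B_right] by auto

lemma FL_br_zero [simp]: "FL_br 0 x = 0" "FL_br x 0 = 0"
  using additive.zero[OF FL.additive_B_left] additive.zero[OF FL.additive_B_right] by auto

lemma t_br_zero [simp]: "t_br 0 x = 0" "t_br x 0 = 0"
  using additive.zero[OF L.additive_B_left] additive.zero[OF L.additive_B_right] by auto

lemma t_br_const_right [simp]: "t_br x (fps_const y) $ k = FL_br (x $ k) y"
proof -
  have "t_br x (fps_const y) $ k = (\<Sum>i\<le>k. if i = k then FL_br (x $ k) y else 0)"
    unfolding t_br_def fps_nth_Abs_fps by (rule sum.cong) auto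
  then show ?thesis by simp
qed

lemma t_br_const_left [simp]: "t_br (fps_const x) y $ k = FL_br x (y $ k)"
  unfolding L.B_anti[of "fps_const x"] fps_neg_nth t_br_const_right by (rule FL.B_anti[symmetric])

lemma t_single_br:
  assumes "lhomog m x" "lhomog n y"
  shows "t_single (m + n) (lbr x y) = t_br (t_single m x) (t_single n y)"
proof (rule t_eqI)
  fix k l
  have "deg_part (t_br (t_single m x) (t_single n y) $ k) l
      = (if k = 0 then
          (\<Sum>i\<le>l. lbr (deg_part (t_single m x $ 0) i) (deg_part (t_single n y $ 0) (l - i))) else 0)"
    unfolding t_single_def[of n] t_br_const_right
    by (simp add: FL_br.rep_eq t_single_def zero_FL.rep_eq)
  also have "\<dots> = (if k = 0 then (\<Sum>i\<le>l. if i = m then if l = m + n then lbr x y else 0 else 0) else 0)"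
    using assms by (intro if_cong sum.cong HOL.refl) (auto simp: deg_part_t_single)
  also have "\<dots> = deg_part (t_single (m + n) (lbr x y) $ k) l"
    using assms by (simp add: deg_part_t_single lhomog.br)
  finally show "deg_part (t_single (m + n) (lbr x y) $ k) l
      = deg_part (t_br (t_single m x) (t_single n y) $ k) l" by simp
qed

lemma low_t_single: "lhomog n x \<Longrightarrow> low n (t_single n x)"
  by (simp add: low_def deg_part_t_single)

lemma const_approx:
  "low n (fps_const x - (\<Sum>j<n. t_single j (deg_part x j)))"
  by (simp add: low_def minus_FL.rep_eq fps_sum_nth deg_part_sum deg_part_t_single
      lhomog_deg_part zero_FL.rep_eq)

lemma const_eq_t_sum: "fps_const x = t_sum (\<lambda>n. t_single n (deg_part x n))"
  by (intro t_sum_eqI low_t_single lhomog_deg_part const_approx)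

lemma t_scale_X_nth: "t_scale fps_X x $ k = (if k = 0 then 0 else x $ (k - 1))"
proof -
  have "t_scale fps_X x $ k = (\<Sum>i\<le>k. if i = 1 then x $ (k - 1) else 0)"
    unfolding t_scale_def fps_nth_Abs_fps by (rule sum.cong) auto
  then show ?thesis by auto
qed

section \<open>Continuous maps are determined by their values on generators\<close>

lemma t_decompose: "x = fps_const (x $ 0) + t_scale fps_X (Abs_fps (\<lambda>k. x $ Suc k))"
  by (simp add: fps_eq_iff t_scale_X_nth)

text \<open>A constant is a limit of finite sums of homogeneous elements, so continuity kills
  \<open>h\<close> on constants. Writing x = x(0) + t x' then gives h(x) = t h(x'), and induction on
  the power of t finishes: linearity over series in t does the work of t-adic continuity.\<close>

lemma t_linear_continuous_eq_0:
  assumes lin: "t_linear h" and cont: "deg_continuous h"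
    and hom: "\<And>n y. lhomog n y \<Longrightarrow> h (t_single n y) = 0"
  shows "h x = 0"
proof -
  have const: "h (fps_const y) = 0" for y
  proof (rule low_eq_0)
    fix n
    obtain m where m: "\<And>x. low (Suc m) x \<Longrightarrow> low (Suc n) (h x)"
      using cont unfolding deg_continuous_def vanishes_upto_low by blast
    have "low (Suc n) (h (fps_const y - (\<Sum>j<Suc m. t_single j (deg_part y j))))"
      by (intro m const_approx)
    then show "low n (h (fps_const y))"
      using low_mono[of "Suc n" _ n]
      by (simp add: t_linearD[OF lin] hom lhomog_deg_part del: sum.lessThan_Suc)
  qed
  have "h x = t_scale fps_X (h (Abs_fps (\<lambda>k. x $ Suc k)))" for x
    by (subst t_decompose[of x]) (simp only: t_linearD[OF lin] const add_0)
  then have step: "h x $ k = (if k = 0 then 0 else h (Abs_fps (\<lambda>k. x $ Suc k)) $ (k - 1))" for x k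
    by (metis t_scale_X_nth)
  have "h x $ k = 0" for x k
    by (induction k arbitrary: x) (subst step, simp)+
  then show ?thesis by (simp add: fps_eq_iff)
qed

lemma t_linear_diff:
  assumes "t_linear f" "t_linear g" shows "t_linear (\<lambda>x. f x - g x)"
  unfolding t_linear_def
  by (simp add: t_linearD(1,2)[OF assms(1)] t_linearD(1,2)[OF assms(2)] T.scale_right_diff_distrib)

lemma deg_continuous_diff:
  assumes "deg_continuous f" "deg_continuous g" shows "deg_continuous (\<lambda>x. f x - g x)"
  unfolding deg_continuous_def vanishes_upto_low
proof
  fix n
  obtain m1 m2 where "\<And>x. low (Suc m1) x \<Longrightarrow> low (Suc n) (f x)"
    "\<And>x. low (Suc m2) x \<Longrightarrow> low (Suc n) (g x)"
    using assms unfolding deg_continuous_def vanishes_upto_low by metis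
  then have "\<forall>x. low (Suc (max m1 m2)) x \<longrightarrow> low (Suc n) (f x - g x)"
    using low_diff low_mono[of "Suc (max m1 m2)"] by (metis Suc_le_mono max.cobounded1 max.cobounded2)
  then show "\<exists>m. \<forall>x. low (Suc m) x \<longrightarrow> low (Suc n) (f x - g x)" ..
qed

lemma deg_continuousI: "(\<And>n x. low n x \<Longrightarrow> low n (f x)) \<Longrightarrow> deg_continuous f"
  unfolding deg_continuous_def vanishes_upto_low by blast

lemma t_linear_continuous_eqI:
  assumes "t_linear f" "deg_continuous f" "t_linear g" "deg_continuous g"
    and "\<And>n y. lhomog n y \<Longrightarrow> f (t_single n y) = g (t_single n y)"
  shows "f = g"
proof
  fix x
  have "f x - g x = 0"
    by (rule t_linear_continuous_eq_0[OF t_linear_diff deg_continuous_diff])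
      (use assms in simp_all)
  then show "f x = g x" by simp
qed

text \<open>Induction along \<open>lhomog\<close> reduces homogeneous elements to generators. This
  is the uniqueness behind the definite description in \<open>tder\<close>;
  \<open>cont_automorphism_eqI\<close> plays the same part for \<open>conj_aut\<close>.\<close>

lemma cont_derivation_eqI:
  assumes D: "cont_derivation D" "cont_derivation D'"
    and gen: "\<And>a. D (t_gen a) = D' (t_gen a)"
  shows "D = D'"
proof (rule t_linear_continuous_eqI)
  show lin: "t_linear D" "t_linear D'" and "deg_continuous D" "deg_continuous D'"
    using D by (simp_all add: cont_derivation_def)
  show "D (t_single n y) = D' (t_single n y)" if "lhomog n y" for n y
    using that
  proof induction
    case (br m x n y)
    then show ?case using D by (simp add: t_single_br cont_derivation_def)
  next
    case (gen a)
    show ?case unfolding t_single_gen by (rule assms(3))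
  qed (simp_all add: t_single_zero t_single_add t_single_scale t_linearD[OF lin(1)]
      t_linearD[OF lin(2)])
qed

lemma cont_automorphism_eqI:
  assumes f: "cont_automorphism f" "cont_automorphism g"
    and gen: "\<And>a. f (t_gen a) = g (t_gen a)"
  shows "f = g"
proof (rule t_linear_continuous_eqI)
  show lin: "t_linear f" "t_linear g" and "deg_continuous f" "deg_continuous g"
    using f by (simp_all add: cont_automorphism_def)
  show "f (t_single n y) = g (t_single n y)" if "lhomog n y" for n y
    using that
  proof induction
    case (br m x n y)
    then show ?case using f by (simp add: t_single_br cont_automorphism_def)
  next
    case (gen a)
    show ?case unfolding t_single_gen by (rule assms(3))
  qed (simp_all add: t_single_zero t_single_add t_single_scale t_linearD[OF lin(1)]
      t_linearD[OF lin(2)])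
qed

text \<open>A derivation along \<open>t_single\<close> is the coefficient of \<open>\<epsilon>\<close> in the Lie homomorphism into
  \<open>L[[\<epsilon>]]\<close> that sends each generator \<open>a\<close> to \<open>a + \<epsilon> d a\<close>.\<close>

lemma free_lie_derivation:
  fixes d :: "'s \<Rightarrow> 's FL fps"
  obtains D where "\<And>a. D (lgen a) = d a"
    and "\<And>x y. D (x + y) = D x + D y" "\<And>c x. D (lscale c x) = t_scale (fps_const c) (D x)"
    and "\<And>m n x y. lhomog m x \<Longrightarrow> lhomog n y \<Longrightarrow>
      D (lbr x y) = t_br (D x) (t_single n y) + t_br (t_single m x) (D y)"
proof -
  interpret E: rat_lie "fps_scale (\<lambda>c. t_scale (fps_const c))" "fps_br t_br :: 's FL fps fps \<Rightarrow> _"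
    by (rule L.rat_lie_fps)
  obtain h :: "'s free_lie \<Rightarrow> 's FL fps fps"
    where gen: "\<And>a. h (lgen a) = Abs_fps (\<lambda>i. if i = 0 then t_gen a else d a)"
      and add: "\<And>x y. h (x + y) = h x + h y"
      and scale: "\<And>c x. h (lscale c x) = fps_scale (\<lambda>c. t_scale (fps_const c)) c (h x)"
      and br: "\<And>x y. h (lbr x y) = fps_br t_br (h x) (h y)"
    by (rule E.free_lie_extension[of "\<lambda>a. Abs_fps (\<lambda>i. if i = 0 then t_gen a else d a)"]) blast
  have zero: "h 0 = 0" using add[of 0 0] by simp
  \<comment> \<open>The constant term of \<open>h\<close> is the embedding of homogeneous elements,
    so the linear term of a bracket is the Leibniz rule.\<close>
  have h0: "h x $ 0 = t_single n x" if "lhomog n x" for n x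
    using that
  proof induction
    case (gen a)
    show ?case unfolding t_single_gen by (simp add: \<open>\<And>a. h (lgen a) = _\<close>)
  qed (simp_all add: add scale br zero fps_scale_def fps_br_def cauchy_def t_single_zero
      t_single_add t_single_scale t_single_br)
  show thesis
  proof (rule that[of "\<lambda>x. h x $ 1"])
    show "h (lbr x y) $ 1 = t_br (h x $ 1) (t_single n y) + t_br (t_single m x) (h y $ 1)"
      if "lhomog m x" "lhomog n y" for m n x y
      unfolding br fps_br_def cauchy_def by (simp add: h0[OF that(1)] h0[OF that(2)])
  qed (simp_all add: gen add scale fps_scale_def)
qed

text \<open>Built in three stages: \<open>D0\<close> on the free Lie algebra, \<open>D1\<close> on
  the completion by summing over degrees, \<open>D2\<close> on series in t by linearity. The level
  bound, which rests on [a, \<open>\<mu> a\<close>] having level m + 1, yields convergence of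
  \<open>D1\<close> and continuity of \<open>D2\<close>.\<close>

lemma cont_derivation_exists:
  fixes \<mu> :: "'s \<Rightarrow> 's FL fps"
  obtains D where "cont_derivation D" "\<And>a. D (t_gen a) = t_br (t_gen a) (\<mu> a)"
    and "\<And>m n x. (\<And>a. low m (\<mu> a)) \<Longrightarrow> low n x \<Longrightarrow> low (n + m) (D x)"
proof -
  obtain D0 where D0_gen: "\<And>a. D0 (lgen a) = t_br (t_gen a) (\<mu> a)"
    and D0_add: "\<And>x y. D0 (x + y) = D0 x + D0 y"
    and D0_scale: "\<And>c x. D0 (lscale c x) = t_scale (fps_const c) (D0 x)"
    and D0_br: "\<And>m n x y. lhomog m x \<Longrightarrow> lhomog n y \<Longrightarrow>
      D0 (lbr x y) = t_br (D0 x) (t_single n y) + t_br (t_single m x) (D0 y)"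
    by (rule free_lie_derivation[of "\<lambda>a. t_br (t_gen a) (\<mu> a)"]) blast
  have D0_additive: "additive D0" by standard (rule D0_add)
  have D0_zero [simp]: "D0 0 = 0" using additive.zero[OF D0_additive] .
  have D0_low: "low (n + m) (D0 x)" if "lhomog n x" "\<And>a. low m (\<mu> a)" for n m x
    using that
  proof (induction rule: lhomog.induct)
    case (gen a)
    then show ?case using low_br_right[of m "\<mu> a" "t_gen a"] by (simp add: D0_gen)
  next
    case (br k x n y)
    then show ?case
      using low_br[of "k + m" "D0 x" n "t_single n y"] low_br[of k "t_single k x" "n + m" "D0 y"]
        low_t_single[of k x] low_t_single[of n y]
      by (simp add: D0_br low_add add.commute add.left_commute)
  qed (simp_all add: D0_add D0_scale low_add low_scale)
  have D0_deg_low: "low n (D0 (deg_part x n))" for x n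
    using D0_low[OF lhomog_deg_part, of 0] by simp
  define D1 where "D1 x = t_sum (\<lambda>n. D0 (deg_part x n))" for x
  have D1_add: "D1 (x + y) = D1 x + D1 y" for x y
    by (simp add: D1_def plus_FL.rep_eq D0_add t_sum_add D0_deg_low)
  have D1_zero [simp]: "D1 0 = 0" using D1_add[of 0 0] by simp
  have D1_scale: "D1 (FL_scale c x) = t_scale (fps_const c) (D1 x)" for c x
    unfolding D1_def FL_scale.rep_eq D0_scale
    by (rule additive_t_sum[symmetric]) (simp_all add: T.scale_right_distrib low_scale D0_deg_low)
  have D1_br: "D1 (FL_br x y) = t_br (D1 x) (fps_const y) + t_br (fps_const x) (D1 y)" for x y
  proof -
    note lows = D0_deg_low low_t_single[OF lhomog_deg_part]
    have low2: "low n (\<Sum>i\<le>n. t_br (u i) (v (n - i)))"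
      if "\<And>i. low i (u i)" "\<And>i. low i (v i)" for u v and n
      by (rule low_sum) (metis that low_br atMost_iff le_add_diff_inverse)
    have "D1 (FL_br x y) = t_sum (\<lambda>n. (\<Sum>i\<le>n. t_br (D0 (deg_part x i)) (t_single (n - i) (deg_part y (n - i))))
        + (\<Sum>i\<le>n. t_br (t_single i (deg_part x i)) (D0 (deg_part y (n - i)))))"
      unfolding D1_def FL_br.rep_eq additive.sum[OF D0_additive]
        D0_br[OF lhomog_deg_part lhomog_deg_part] sum.distrib ..
    also have "\<dots> = t_br (D1 x) (fps_const y) + t_br (fps_const x) (D1 y)"
      unfolding const_eq_t_sum D1_def t_br_t_sum[OF lows] t_br_t_sum[OF lows(2,1)]
      by (rule t_sum_add; rule low2; rule lows)
    finally show ?thesis .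
  qed
  have D1_gen: "D1 (FL_gen a) = t_br (t_gen a) (\<mu> a)" for a
  proof -
    have "D1 (FL_gen a) = t_sum (\<lambda>n. D0 (if n = 1 then lgen a else 0))"
      by (simp add: D1_def FL_gen.rep_eq)
    moreover have "low n (D0 (if n = 1 then lgen a else 0))" for n
      using D0_deg_low[of n "FL_gen a"] by (simp add: FL_gen.rep_eq)
    ultimately show ?thesis
      \<comment> \<open>Two shifts split off the indices 0 and 1; all terms but that of index 1 are
        \<open>D0 0\<close>.\<close>
      using t_sum_shift[of "\<lambda>n. D0 (if n = 1 then lgen a else 0)"]
        t_sum_shift[of "\<lambda>n. D0 (if Suc n = 1 then lgen a else 0)"]
      by (simp add: D0_gen)
  qed
  have D1_low: "low (n + m) (D1 x)"
    if \<mu>: "\<And>a. low m (\<mu> a)" and x: "\<forall>i<n. deg_part x i = 0" for m n x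
    unfolding D1_def
  proof (rule low_t_sum[OF D0_deg_low])
    fix j
    show "low (n + m) (D0 (deg_part x j))"
    proof (cases "j < n")
      case False
      then show ?thesis using low_mono[OF D0_low[OF lhomog_deg_part \<mu>]] by simp
    qed (use x in simp)
  qed
  \<comment> \<open>The coefficient of t^n in the sum of t^i \<open>D1 (x $ i)\<close> is a
    convolution whose second sequence is the identity on indices.\<close>
  let ?P = "\<lambda>x k. D1 x $ k"
  define D2 where "D2 x = Abs_fps (cauchy ?P (fps_nth x) (\<lambda>k. k))" for x
  have D2_nth: "fps_nth (D2 x) = cauchy ?P (fps_nth x) (\<lambda>k. k)" for x
    by (simp add: fun_eq_iff D2_def)
  have P_add: "additive (\<lambda>x. D1 x $ k)" for k
    by standard (simp add: D1_add)
  have D2_const: "D2 (fps_const x) = D1 x" for x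
  proof -
    have "cauchy ?P (fps_nth (fps_const x)) (\<lambda>k. k) n = (\<Sum>i\<le>n. if i = 0 then D1 x $ n else 0)" for n
      unfolding cauchy_def by (rule sum.cong) auto
    then show ?thesis by (simp add: D2_def fps_eq_iff)
  qed
  have "t_linear D2"
    unfolding t_linear_def
  proof (intro conjI allI)
    fix x y :: "'s FL fps" and p
    show "D2 (x + y) = D2 x + D2 y"
      by (simp add: D2_def fps_eq_iff cauchy_def D1_add sum.distrib)
    have sc: "fps_nth (t_scale p z) = cauchy FL_scale (fps_nth p) (fps_nth z)" for z :: "'s FL fps"
      by (simp add: fun_eq_iff t_scale_nth)
    show "D2 (t_scale p x) = t_scale p (D2 x)"
      unfolding fps_eq_iff D2_nth sc
      by (intro allI cauchy_assoc P_add) (simp_all add: additive_def FL.scale_right_distrib D1_scale)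
  qed
  moreover have D2_br: "D2 (t_br x y) = t_br (D2 x) y + t_br x (D2 y)" for x y
  proof (rule fps_ext)
    fix n
    have br: "fps_nth (t_br x y) = cauchy FL_br (fps_nth x) (fps_nth y)" for x y :: "'s FL fps"
      by (simp add: fun_eq_iff t_br_nth)
    have "D2 (t_br x y) $ n
        = (\<Sum>i\<le>n. \<Sum>j\<le>n - i. FL_br (D1 (x $ i) $ (n - i - j)) (y $ j))
          + (\<Sum>i\<le>n. \<Sum>j\<le>n - i. FL_br (x $ i) (D1 (y $ j) $ (n - i - j)))"
      unfolding D2_nth br cauchy_def additive.sum[OF P_add]
        sum_triangle_assoc[of "\<lambda>i j k. D1 (FL_br (x $ i) (y $ j)) $ k"] sum.distrib[symmetric]
      by (simp add: D1_br)
    also have "(\<Sum>i\<le>n. \<Sum>j\<le>n - i. FL_br (D1 (x $ i) $ (n - i - j)) (y $ j)) = t_br (D2 x) y $ n"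
      unfolding br D2_nth cauchy_def FL.B_sum_left
        sum_triangle_assoc[of "\<lambda>i j k. FL_br (D1 (x $ i) $ j) (y $ k)"]
      by (rule sum.cong[OF HOL.refl])
        (rule sum_flip[of "\<lambda>j k. FL_br (D1 (x $ i) $ j) (y $ k)" for i, symmetric])
    also have "(\<Sum>i\<le>n. \<Sum>j\<le>n - i. FL_br (x $ i) (D1 (y $ j) $ (n - i - j))) = t_br x (D2 y) $ n"
      unfolding br D2_nth cauchy_def FL.B_sum_right ..
    finally show "D2 (t_br x y) $ n = (t_br (D2 x) y + t_br x (D2 y)) $ n" by simp
  qed
  moreover have D2_low: "low (n + m) (D2 x)" if "\<And>a. low m (\<mu> a)" "low n x" for m n x
  proof -
    have "low (n + m) (D1 (x $ k))" for k
      by (rule D1_low) (use that in \<open>simp_all add: low_def\<close>)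
    then show ?thesis
      by (simp add: low_def D2_nth cauchy_def deg_part_sum)
  qed
  moreover have "deg_continuous D2"
    by (rule deg_continuousI) (use D2_low[of 0] in simp)
  moreover have "D2 (t_gen a) = t_br (t_gen a) (\<mu> a)" for a
    by (simp add: t_gen_def D2_const D1_gen)
  ultimately show thesis
    using that[of D2] by (simp add: cont_derivation_def)
qed

lemma tder_eqI:
  assumes "cont_derivation D" "\<And>a. D (t_gen a) = t_br (t_gen a) (\<mu> a)"
  shows "tder \<mu> = D"
  unfolding tder_def
proof (rule the_equality)
  show "D' = D" if "cont_derivation D' \<and> (\<forall>a. D' (t_gen a) = t_br (t_gen a) (\<mu> a))" for D'
    by (rule cont_derivation_eqI) (use that assms in simp_all)
qed (use assms in simp)

lemma tder_derivation: "cont_derivation (tder \<mu>)"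
  and tder_gen: "tder \<mu> (t_gen a) = t_br (t_gen a) (\<mu> a)"
  and tder_low: "(\<And>a. low m (\<mu> a)) \<Longrightarrow> low n x \<Longrightarrow> low (n + m) (tder \<mu> x)"
  by (rule cont_derivation_exists[of \<mu>], metis tder_eqI)+

lemma tder_linear: "t_linear (tder \<mu>)"
  and tder_br: "tder \<mu> (t_br x y) = t_br (tder \<mu> x) y + t_br x (tder \<mu> y)"
  using tder_derivation[of \<mu>] by (simp_all add: cont_derivation_def)

section \<open>Identities between tangential derivations\<close>

lemmas tder_simps = t_linearD[OF tder_linear]

lemma tder_raise: "low n x \<Longrightarrow> low (Suc n) (tder \<mu> x)"
  using tder_low[of 1 \<mu> n x] by simp

lemma tder_low_param: "(\<And>a. low m (\<mu> a)) \<Longrightarrow> low (Suc m) (tder \<mu> x)"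
  using tder_low[of m \<mu> 1 x] by simp

lemma cont_derivationI:
  assumes "\<And>x y. D (x + y) = D x + D y" "\<And>p x. D (t_scale p x) = t_scale p (D x)"
    and "\<And>n x. low n x \<Longrightarrow> low n (D x)"
    and "\<And>x y. D (t_br x y) = t_br (D x) y + t_br x (D y)"
  shows "cont_derivation D"
  unfolding cont_derivation_def t_linear_def using assms deg_continuousI[of D] by simp

lemma tder_low_same: "low n x \<Longrightarrow> low n (tder \<mu> x)"
  using tder_raise low_mono le_SucI order_refl by metis

text \<open>Here and in the next three lemmas the other side is shown to be a continuous derivation
  with the right values on generators, and uniqueness concludes.\<close>

lemma tder_add: "tder (\<lambda>a. \<mu> a + \<nu> a) x = tder \<mu> x + tder \<nu> x"
proof -
  have "tder (\<lambda>a. \<mu> a + \<nu> a) = (\<lambda>x. tder \<mu> x + tder \<nu> x)"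
    by (intro tder_eqI cont_derivationI low_add tder_low_same)
      (simp_all add: tder_simps tder_br tder_gen T.scale_right_distrib L.B_add_left L.B_add_right)
  then show ?thesis by simp
qed

lemma tder_scale: "tder (\<lambda>a. t_scale p (\<mu> a)) x = t_scale p (tder \<mu> x)"
proof -
  have "tder (\<lambda>a. t_scale p (\<mu> a)) = (\<lambda>x. t_scale p (tder \<mu> x))"
    by (intro tder_eqI cont_derivationI low_scale tder_low_same)
      (simp_all add: tder_simps tder_br tder_gen T.scale_right_distrib t_br_scale_left
        t_br_scale_right mult.commute)
  then show ?thesis by simp
qed

lemma tder_commutator:
  "tder \<mu> (tder \<nu> x) - tder \<nu> (tder \<mu> x) = tder (ad_tb \<mu> \<nu>) x"
proof -
  have "tder (ad_tb \<mu> \<nu>) = (\<lambda>x. tder \<mu> (tder \<nu> x) - tder \<nu> (tder \<mu> x))"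
  proof (intro tder_eqI cont_derivationI low_diff tder_low_same)
    fix a
    \<comment> \<open>On a generator the commutator consists of these two double brackets, merged by
      Jacobi, and of the bracket of the generator with
      \<open>tder \<mu> (\<nu> a) - tder \<nu> (\<mu> a)\<close>. Together they give the three terms
      of \<open>ad_tb\<close>.\<close>
    have "t_br (t_br (t_gen a) (\<mu> a)) (\<nu> a) - t_br (t_br (t_gen a) (\<nu> a)) (\<mu> a)
        = t_br (t_gen a) (t_br (\<mu> a) (\<nu> a))"
      using L.B_jacobi[of "t_gen a" "\<mu> a" "\<nu> a"] L.B_anti[of "\<mu> a" "t_br (t_gen a) (\<nu> a)"]
      by (simp add: algebra_simps)
    then show "tder \<mu> (tder \<nu> (t_gen a)) - tder \<nu> (tder \<mu> (t_gen a))
        = t_br (t_gen a) (ad_tb \<mu> \<nu> a)"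
      by (simp add: tder_gen tder_br ad_tb_def L.B_add_right additive.diff[OF L.additive_B_right]
          algebra_simps)
  qed (simp_all add: tder_simps tder_br T.scale_right_diff_distrib L.B_add_left L.B_add_right
      additive.diff[OF L.additive_B_right] additive.diff[OF L.additive_B_left])
  then show ?thesis by simp
qed

text \<open>Although d/dt is not linear over series in t, its commutator with a linear map is: the
  terms that differentiate the scalar cancel. Generators are constant in t.\<close>

lemma tder_t_deriv:
  "t_deriv (tder \<mu> x) - tder \<mu> (t_deriv x) = tder (\<lambda>a. t_deriv (\<mu> a)) x"
proof -
  have "tder (\<lambda>a. t_deriv (\<mu> a)) = (\<lambda>x. t_deriv (tder \<mu> x) - tder \<mu> (t_deriv x))"
    by (intro tder_eqI cont_derivationI low_diff low_deriv tder_low_same)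
      (simp_all add: tder_simps tder_br tder_gen t_deriv_add t_deriv_br t_deriv_scale
        T.scale_right_diff_distrib L.B_add_left L.B_add_right
        additive.diff[OF L.additive_B_right] additive.diff[OF L.additive_B_left])
  then show ?thesis by simp
qed

section \<open>Series in degree-raising operators\<close>

text \<open>Only rational linearity is demanded, so that \<open>t_deriv\<close> qualifies with d =
  0.\<close>

definition raises :: "nat \<Rightarrow> ('s FL fps \<Rightarrow> 's FL fps) \<Rightarrow> bool" where
  "raises d T \<longleftrightarrow> (\<forall>x y. T (x + y) = T x + T y)
     \<and> (\<forall>c x. T (t_scale (fps_const c) x) = t_scale (fps_const c) (T x))
     \<and> (\<forall>n x. low n x \<longrightarrow> low (n + d) (T x))"

lemma raisesD:
  assumes "raises d T"
  shows "T (x + y) = T x + T y" "T (t_scale (fps_const c) x) = t_scale (fps_const c) (T x)"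
    "low n x \<Longrightarrow> low (n + d) (T x)" "T 0 = 0" "T (- x) = - T x"
    "T (sum g A) = (\<Sum>i\<in>A. T (g i))"
proof -
  have a: "additive T" using assms by (simp add: raises_def additive_def)
  show "T (x + y) = T x + T y" "T (t_scale (fps_const c) x) = t_scale (fps_const c) (T x)"
    "low n x \<Longrightarrow> low (n + d) (T x)"
    using assms by (simp_all add: raises_def)
  show "T 0 = 0" "T (- x) = - T x" "T (sum g A) = (\<Sum>i\<in>A. T (g i))"
    using a by (rule additive.zero additive.minus additive.sum)+
qed

lemma raises_uminus: "raises d T \<Longrightarrow> raises d (\<lambda>x. - T x)"
  by (simp add: raises_def low_uminus)

lemma raises_tder: "raises 1 (tder \<mu>)"
  by (simp add: raises_def tder_simps tder_raise)

lemma raises_deriv: "raises 0 t_deriv"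
  by (simp add: raises_def t_deriv_add t_deriv_scale low_deriv)

lemma raises_funpow: "raises d T \<Longrightarrow> raises (j * d) (T ^^ j)"
proof (induction j)
  case (Suc j)
  have "low (n + (d + j * d)) (T ((T ^^ j) x))" if "low n x" for n x
    using raisesD(3)[OF Suc.prems raisesD(3)[OF Suc.IH[OF Suc.prems] that]]
    by (simp add: algebra_simps)
  then show ?case
    using raisesD(1,2)[OF Suc.prems] raisesD(1,2)[OF Suc.IH[OF Suc.prems]] by (simp add: raises_def)
qed (simp add: raises_def)

lemma op_series_low_term:
  "raises 1 T \<Longrightarrow> low n x \<Longrightarrow> low (n + j) (t_scale p ((T ^^ j) x))"
  using raisesD(3)[OF raises_funpow[of 1 T j]] by (auto intro: low_scale)

lemma op_series_low_term0: "raises 1 T \<Longrightarrow> low j (t_scale p ((T ^^ j) x))"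
  using op_series_low_term[of T 0 x] by simp

lemma op_series_add: "raises 1 T \<Longrightarrow> op_series p T (x + y) = op_series p T x + op_series p T y"
  by (simp add: op_series_def raisesD(1)[OF raises_funpow] T.scale_right_distrib t_sum_add
      op_series_low_term0)

lemma op_series_low: "raises 1 T \<Longrightarrow> low n x \<Longrightarrow> low n (op_series p T x)"
  unfolding op_series_def
  by (intro low_t_sum op_series_low_term0 low_mono[OF op_series_low_term]) auto

lemma op_series_linear:
  assumes "raises 1 T" "t_linear T" shows "t_linear (op_series p T)"
  unfolding t_linear_def
proof (intro conjI allI)
  show "op_series p T (x + y) = op_series p T x + op_series p T y" for x y
    using assms(1) by (rule op_series_add)
  fix q x
  have "(T ^^ j) (t_scale q x) = t_scale q ((T ^^ j) x)" for j
    by (induction j) (simp_all add: t_linearD[OF assms(2)])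
  then have "op_series p T (t_scale q x) = t_sum (\<lambda>j. t_scale q (t_scale (fps_const (p $ j)) ((T ^^ j) x)))"
    by (simp add: op_series_def mult.commute)
  also have "\<dots> = t_scale q (op_series p T x)"
    unfolding op_series_def using assms(1)
    by (intro additive_t_sum[symmetric] T.scale_right_distrib low_scale op_series_low_term0)
  finally show "op_series p T (t_scale q x) = t_scale q (op_series p T x)" .
qed

section \<open>Binomial expansions and exponentials of operators\<close>

lemma pascal_sum:
  fixes f :: "nat \<Rightarrow> nat \<Rightarrow> 's FL fps"
  shows "(\<Sum>i\<le>n. t_scale (fps_const (of_nat (n choose i))) (f (Suc i) (n - i) + f i (Suc (n - i))))
    = (\<Sum>i\<le>Suc n. t_scale (fps_const (of_nat (Suc n choose i))) (f i (Suc n - i)))"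
proof -
  let ?q = "\<lambda>m i. t_scale (fps_const (of_nat (m choose i)))"
  \<comment> \<open>The added term i = n + 1 has binomial coefficient 0.\<close>
  have "(\<Sum>i\<le>n. ?q n i (f i (Suc (n - i)))) = (\<Sum>i\<le>Suc n. ?q n i (f i (Suc n - i)))"
    by (simp add: Suc_diff_le)
  also have "\<dots> = f 0 (Suc n) + (\<Sum>i\<le>n. ?q n (Suc i) (f (Suc i) (n - i)))"
    unfolding sum.atMost_Suc_shift by simp
  finally have s: "(\<Sum>i\<le>n. ?q n i (f i (Suc (n - i))))
      = f 0 (Suc n) + (\<Sum>i\<le>n. ?q n (Suc i) (f (Suc i) (n - i)))" .
  have "(\<Sum>i\<le>Suc n. ?q (Suc n) i (f i (Suc n - i)))
      = f 0 (Suc n) + (\<Sum>i\<le>n. ?q (Suc n) (Suc i) (f (Suc i) (n - i)))"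
    unfolding sum.atMost_Suc_shift by simp
  also have "(\<Sum>i\<le>n. ?q (Suc n) (Suc i) (f (Suc i) (n - i)))
      = (\<Sum>i\<le>n. ?q n i (f (Suc i) (n - i))) + (\<Sum>i\<le>n. ?q n (Suc i) (f (Suc i) (n - i)))"
    by (simp add: L.scale_left_distrib sum.distrib)
  finally show ?thesis by (simp add: T.scale_right_distrib sum.distrib s algebra_simps)
qed

lemma exp_scale_binomial:
  assumes "i \<le> n"
  shows "t_scale (fps_const (1 / fact n)) (t_scale (fps_const (of_nat (n choose i))) x)
    = t_scale (fps_const (1 / fact i)) (t_scale (fps_const (1 / fact (n - i))) x)"
  using assms by (simp add: binomial_fact)

definition op_ad :: "('s FL fps \<Rightarrow> 's FL fps) \<Rightarrow> ('s FL fps \<Rightarrow> 's FL fps) \<Rightarrow> 's FL fps \<Rightarrow> 's FL fps" where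
  "op_ad D T = (\<lambda>x. D (T x) - T (D x))"

text \<open>\<open>op_ad D\<close> is left composition with D plus right composition with -D. These
  commute, so this is the binomial theorem; the sign stays inside the power to match the series of
  e^(-D).\<close>

lemma op_ad_funpow:
  assumes D: "raises 1 D" and T: "raises 0 T"
  shows "(op_ad D ^^ n) T x
    = (\<Sum>i\<le>n. t_scale (fps_const (of_nat (n choose i))) ((D ^^ i) (T (((\<lambda>x. - D x) ^^ (n - i)) x))))"
proof (induction n arbitrary: x)
  case (Suc n)
  let ?N = "\<lambda>x. - D x"
  note N = raises_funpow[OF raises_uminus[OF D]]
  have "(?N ^^ m) (D x) = - (?N ^^ Suc m) x" for m x
    unfolding funpow_Suc_right o_def raisesD(5)[OF N] by simp
  then have step: "- (D ^^ i) (T ((?N ^^ m) (D x))) = (D ^^ i) (T ((?N ^^ Suc m) x))" for i m x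
    by (simp only: raisesD(5)[OF T] raisesD(5)[OF raises_funpow[OF D]] minus_minus)
  have "(op_ad D ^^ Suc n) T x = D ((op_ad D ^^ n) T x) - (op_ad D ^^ n) T (D x)"
    by (simp add: op_ad_def)
  also have "\<dots> = (\<Sum>i\<le>n. t_scale (fps_const (of_nat (n choose i)))
      ((D ^^ Suc i) (T ((?N ^^ (n - i)) x)) + (D ^^ i) (T ((?N ^^ Suc (n - i)) x))))"
    unfolding Suc.IH step[symmetric]
    by (simp add: raisesD[OF D] T.scale_right_diff_distrib sum_subtractf)
  finally show ?case
    using pascal_sum[of n "\<lambda>i j. (D ^^ i) (T ((?N ^^ j) x))"] by simp
qed simp

text \<open>This is e^D T e^(-D) = e^(ad D) T. The powers of D put the term (i, j) into level i + j,
  so the double series may be summed along antidiagonals, where 1/(i! (n - i)!) produces the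
  binomial coefficients of \<open>op_ad_funpow\<close>.\<close>

lemma op_exp_conjugate:
  assumes D: "raises 1 D" and T: "raises 0 T"
  shows "op_exp D (T (op_exp (\<lambda>x. - D x) x))
    = t_sum (\<lambda>n. t_scale (fps_const (1 / fact n)) ((op_ad D ^^ n) T x))"
proof -
  let ?N = "\<lambda>x. - D x" and ?q = "\<lambda>i. t_scale (fps_const (1 / fact i))"
  note N = raises_uminus[OF D]
  note Di = raisesD[OF raises_funpow[OF D]]
  have lowD: "low (n + i) ((D ^^ i) (T y))" if "low n y" for n i y
    using Di(3)[of "n + 0" "T y" i] raisesD(3)[OF T that] by simp
  have "op_exp D (T (op_exp ?N x)) = t_sum (\<lambda>i. ?q i ((D ^^ i) (T (t_sum (\<lambda>j. ?q j ((?N ^^ j) x))))))"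
    by (simp add: op_series_def)
  also have "\<dots> = t_sum (\<lambda>i. t_sum (\<lambda>j. ?q i ((D ^^ i) (T (?q j ((?N ^^ j) x))))))"
  proof (intro arg_cong[where f = t_sum] ext)
    fix i
    show "?q i ((D ^^ i) (T (t_sum (\<lambda>j. ?q j ((?N ^^ j) x)))))
        = t_sum (\<lambda>j. ?q i ((D ^^ i) (T (?q j ((?N ^^ j) x)))))"
      by (rule additive_t_sum)
        (simp_all add: raisesD(1)[OF T] Di(1) T.scale_right_distrib low_scale low_mono[OF lowD]
          op_series_low_term0[OF N])
  qed
  also have "\<dots> = t_sum (\<lambda>n. \<Sum>i\<le>n. ?q i ((D ^^ i) (T (?q (n - i) ((?N ^^ (n - i)) x)))))"
    by (rule t_sum_t_sum, rule low_scale, subst add.commute, rule lowD, rule op_series_low_term0[OF N])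
  also have "\<dots> = t_sum (\<lambda>n. ?q n ((op_ad D ^^ n) T x))"
    unfolding op_ad_funpow[OF assms] T.scale_sum_right raisesD(2)[OF T] Di(2)
    by (intro arg_cong[where f = t_sum] ext sum.cong HOL.refl) (simp only: exp_scale_binomial atMost_iff)
  finally show ?thesis .
qed

text \<open>Conjugation of the identity operator: \<open>op_ad D\<close> annihilates it, so only n =
  0 survives.\<close>

lemma op_exp_inverse:
  assumes D: "raises 1 D"
  shows "op_exp D (op_exp (\<lambda>x. - D x) x) = x"
proof -
  have T: "raises 0 (\<lambda>x. x)" by (simp add: raises_def)
  have ad: "op_ad D (\<lambda>x. x) = (\<lambda>x. 0)" "op_ad D (\<lambda>x. 0) = (\<lambda>x. 0)"
    by (simp_all add: op_ad_def raisesD(4)[OF D])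
  have adn: "(op_ad D ^^ Suc n) (\<lambda>x. x) = (\<lambda>x. 0)" for n
    by (induction n) (simp_all add: ad)
  let ?u = "\<lambda>n. t_scale (fps_const (1 / fact n)) ((op_ad D ^^ n) (\<lambda>x. x) x)"
  have "low n (?u n)" for n
    by (cases n) (simp_all only: adn low_zero T.scale_zero_right low_0)
  then have "t_sum ?u = ?u 0 + t_sum (\<lambda>n. ?u (Suc n))" by (rule t_sum_shift)
  then show ?thesis
    unfolding op_exp_conjugate[OF D T] adn by simp
qed

lemma op_exp_br:
  assumes D: "raises 1 D" and der: "\<And>x y. D (t_br x y) = t_br (D x) y + t_br x (D y)"
  shows "op_exp D (t_br x y) = t_br (op_exp D x) (op_exp D y)"
proof -
  let ?q = "\<lambda>i. t_scale (fps_const (1 / fact i))"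
  have leibniz: "(D ^^ n) (t_br x y)
      = (\<Sum>i\<le>n. t_scale (fps_const (of_nat (n choose i))) (t_br ((D ^^ i) x) ((D ^^ (n - i)) y)))" for n
  proof (induction n)
    case (Suc n)
    then show ?case
      using pascal_sum[of n "\<lambda>i j. t_br ((D ^^ i) x) ((D ^^ j) y)"] by (simp add: raisesD[OF D] der)
  qed simp
  have "op_exp D (t_br x y) = t_sum (\<lambda>n. \<Sum>i\<le>n. t_br (?q i ((D ^^ i) x)) (?q (n - i) ((D ^^ (n - i)) y)))"
    unfolding op_series_def leibniz T.scale_sum_right t_br_scale_left t_br_scale_right
    by (intro arg_cong[where f = t_sum] ext sum.cong HOL.refl)
      (simp only: exp_scale_binomial atMost_iff fps_exp_nth power_one of_nat_fact,
        simp add: mult.commute)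
  also have "\<dots> = t_br (op_exp D x) (op_exp D y)"
    unfolding op_series_def fps_exp_nth power_one of_nat_fact
    by (intro t_br_t_sum[symmetric] op_series_low_term0 D)
  finally show ?thesis .
qed

lemma op_exp_automorphism:
  assumes "cont_derivation D" "raises 1 D"
  shows "cont_automorphism (op_exp D)"
proof -
  have der: "t_linear D" "\<And>x y. D (t_br x y) = t_br (D x) y + t_br x (D y)"
    using assms(1) by (simp_all add: cont_derivation_def)
  have "op_exp D \<circ> op_exp (\<lambda>x. - D x) = id"
    using op_exp_inverse[OF assms(2)] by (simp add: fun_eq_iff)
  moreover have "op_exp (\<lambda>x. - D x) \<circ> op_exp D = id"
    using op_exp_inverse[OF raises_uminus[OF assms(2)]] by (simp add: fun_eq_iff)
  ultimately have "bij (op_exp D)" by (metis o_bij)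
  then show ?thesis
    using assms(2) der
    by (simp add: cont_automorphism_def op_series_linear op_exp_br deg_continuousI op_series_low)
qed

section \<open>Series in operators on families\<close>

definition raises_fam :: "(('s \<Rightarrow> 's FL fps) \<Rightarrow> ('s \<Rightarrow> 's FL fps)) \<Rightarrow> bool" where
  "raises_fam T \<longleftrightarrow> (\<forall>\<mu> \<nu>. T (\<lambda>a. \<mu> a + \<nu> a) = (\<lambda>a. T \<mu> a + T \<nu> a))
     \<and> (\<forall>c \<mu>. T (\<lambda>a. t_scale (fps_const c) (\<mu> a)) = (\<lambda>a. t_scale (fps_const c) (T \<mu> a)))
     \<and> (\<forall>n \<mu>. (\<forall>a. low n (\<mu> a)) \<longrightarrow> (\<forall>a. low (Suc n) (T \<mu> a)))"

text \<open>The component at a of \<open>ad_tb \<mu> \<nu>\<close> involves all of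
  \<open>\<nu>\<close> through \<open>tder \<nu> (\<mu> a)\<close>, hence operators on whole
  families. That term gains its level from the parameter of the derivation, not from its
  argument.\<close>

lemma raises_fam_ad_tb: "raises_fam (ad_tb \<mu>)"
proof -
  have "low (Suc n) (ad_tb \<mu> \<nu> a)" if "\<forall>a. low n (\<nu> a)" for n \<nu> a
    using that unfolding ad_tb_def
    by (intro low_diff low_add low_br_right tder_raise tder_low_param) auto
  moreover have "ad_tb \<mu> (\<lambda>a. \<nu> a + \<nu>' a) = (\<lambda>a. ad_tb \<mu> \<nu> a + ad_tb \<mu> \<nu>' a)" for \<nu> \<nu>'
    by (simp add: ad_tb_def fun_eq_iff L.B_add_right tder_simps tder_add algebra_simps)
  moreover have "ad_tb \<mu> (\<lambda>a. t_scale p (\<nu> a)) = (\<lambda>a. t_scale p (ad_tb \<mu> \<nu> a))" for p \<nu>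
    by (simp add: ad_tb_def fun_eq_iff t_br_scale_right tder_simps tder_scale
        T.scale_right_distrib T.scale_right_diff_distrib)
  ultimately show ?thesis by (simp add: raises_fam_def)
qed

lemma raises_fam_funpow:
  assumes "raises_fam T"
  shows "(T ^^ j) (\<lambda>a. \<mu> a + \<nu> a) a = (T ^^ j) \<mu> a + (T ^^ j) \<nu> a"
    and "(T ^^ j) (\<lambda>a. t_scale (fps_const c) (\<mu> a)) a = t_scale (fps_const c) ((T ^^ j) \<mu> a)"
    and "(\<And>a. low n (\<mu> a)) \<Longrightarrow> low (n + j) ((T ^^ j) \<mu> a)"
proof -
  have "(T ^^ j) (\<lambda>a. \<mu> a + \<nu> a) = (\<lambda>a. (T ^^ j) \<mu> a + (T ^^ j) \<nu> a)"
    by (induction j) (use assms in \<open>simp_all add: raises_fam_def\<close>)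
  then show "(T ^^ j) (\<lambda>a. \<mu> a + \<nu> a) a = (T ^^ j) \<mu> a + (T ^^ j) \<nu> a" by simp
  have "(T ^^ j) (\<lambda>a. t_scale (fps_const c) (\<mu> a)) = (\<lambda>a. t_scale (fps_const c) ((T ^^ j) \<mu> a))"
    by (induction j) (use assms in \<open>simp_all add: raises_fam_def\<close>)
  then show "(T ^^ j) (\<lambda>a. t_scale (fps_const c) (\<mu> a)) a = t_scale (fps_const c) ((T ^^ j) \<mu> a)"
    by simp
  have "(\<forall>a. low n (\<mu> a)) \<longrightarrow> (\<forall>a. low (n + j) ((T ^^ j) \<mu> a))"
    by (induction j) (use assms in \<open>simp_all add: raises_fam_def\<close>)
  then show "(\<And>a. low n (\<mu> a)) \<Longrightarrow> low (n + j) ((T ^^ j) \<mu> a)" by blast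
qed

lemma raises_fam_low: "raises_fam T \<Longrightarrow> low j (t_scale p ((T ^^ j) \<mu> a))"
  using raises_fam_funpow(3)[of T 0 \<mu> j a] by (simp add: low_scale)

text \<open>Multiplicativity of the substitution: reciprocal power series give inverse operators,
  which is how the differential equation gets inverted.\<close>

lemma op_series_fam_mult:
  assumes T: "raises_fam T"
  shows "op_series_fam p T (op_series_fam q T \<nu>) = op_series_fam (p * q) T \<nu>"
proof
  fix a
  let ?s = "\<lambda>c. t_scale (fps_const c)"
  have "op_series_fam p T (op_series_fam q T \<nu>) a
      = t_sum (\<lambda>i. t_sum (\<lambda>j. ?s (p $ i) ((T ^^ i) (\<lambda>a. ?s (q $ j) ((T ^^ j) \<nu> a)) a)))"
    unfolding op_series_fam_def
  proof (intro arg_cong[where f = t_sum] ext)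
    fix i
    have lowT: "low n ((T ^^ i) \<mu> a)" if "\<And>a. low n (\<mu> a)" for n \<mu>
      by (rule low_mono[OF raises_fam_funpow(3)[OF T that]]) simp
    show "?s (p $ i) ((T ^^ i) (\<lambda>a. t_sum (\<lambda>j. ?s (q $ j) ((T ^^ j) \<nu> a))) a)
        = t_sum (\<lambda>j. ?s (p $ i) ((T ^^ i) (\<lambda>a. ?s (q $ j) ((T ^^ j) \<nu> a)) a))"
      by (rule additive_t_sum_fam[of "\<lambda>\<mu>. ?s (p $ i) ((T ^^ i) \<mu> a)"])
        (simp_all add: raises_fam_funpow(1)[OF T] T.scale_right_distrib low_scale
          lowT raises_fam_low[OF T])
  qed
  also have "\<dots> = t_sum (\<lambda>i. t_sum (\<lambda>j. ?s (p $ i * q $ j) ((T ^^ (i + j)) \<nu> a)))"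
    by (simp add: raises_fam_funpow(2)[OF T] funpow_add)
  also have "\<dots> = t_sum (\<lambda>n. \<Sum>i\<le>n. ?s (p $ i * q $ (n - i)) ((T ^^ (i + (n - i))) \<nu> a))"
    by (rule t_sum_t_sum) (rule raises_fam_low[OF T])
  also have "\<dots> = op_series_fam (p * q) T \<nu> a"
    unfolding op_series_fam_def fps_mult_nth atLeast0AtMost L.scale_sum_left by simp
  finally show "op_series_fam p T (op_series_fam q T \<nu>) a = op_series_fam (p * q) T \<nu> a" .
qed

lemma op_series_fam_one: "op_series_fam 1 T \<nu> = \<nu>"
proof
  fix a
  have "op_series_fam 1 T \<nu> a = t_sum (\<lambda>j. if j = 0 then \<nu> a else 0)"
    unfolding op_series_fam_def by (rule arg_cong[where f = t_sum]) (auto simp: fun_eq_iff)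
  also have "\<dots> = \<nu> a"
    by (subst t_sum_shift) auto
  finally show "op_series_fam 1 T \<nu> a = \<nu> a" .
qed

section \<open>The differential equation\<close>

definition t_agree :: "nat \<Rightarrow> 's FL fps \<Rightarrow> 's FL fps \<Rightarrow> bool" where
  "t_agree k x y \<longleftrightarrow> (\<forall>i<k. x $ i = y $ i)"

lemma t_scale_X_power_nth: "t_scale (fps_X ^ k) x $ n = (if n < k then 0 else x $ (n - k))"
proof -
  have "t_scale (fps_X ^ k) x $ n = (\<Sum>i\<le>n. if i = k then x $ (n - k) else 0)"
    unfolding t_scale_def fps_nth_Abs_fps by (rule sum.cong) (auto simp: fps_X_power_nth)
  then show ?thesis by auto
qed

text \<open>In this divisibility form, congruence is preserved by anything linear over series in t,
  in particular by \<open>tder\<close> in its argument and in its parameter.\<close>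

lemma t_agree_iff: "t_agree k x y \<longleftrightarrow> (\<exists>z. x = y + t_scale (fps_X ^ k) z)"
proof
  assume "t_agree k x y"
  then have "x = y + t_scale (fps_X ^ k) (Abs_fps (\<lambda>n. (x - y) $ (n + k)))"
    by (auto simp: fps_eq_iff t_scale_X_power_nth t_agree_def)
  then show "\<exists>z. x = y + t_scale (fps_X ^ k) z" ..
qed (auto simp: t_agree_def t_scale_X_power_nth)

lemma t_agree_tder:
  assumes "\<And>a. t_agree k (\<mu> a) (\<nu> a)" "t_agree k x y"
  shows "t_agree k (tder \<mu> x) (tder \<nu> y)"
proof -
  obtain \<zeta> where "\<And>a. \<mu> a = \<nu> a + t_scale (fps_X ^ k) (\<zeta> a)"
    using assms(1) unfolding t_agree_iff by metis
  then have \<mu>: "\<mu> = (\<lambda>a. \<nu> a + t_scale (fps_X ^ k) (\<zeta> a))" by blast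
  obtain z where x: "x = y + t_scale (fps_X ^ k) z"
    using assms(2) unfolding t_agree_iff by blast
  \<comment> \<open>First the argument is changed under \<open>tder \<mu>\<close>, then the
    parameter at the fixed argument y.\<close>
  have "tder \<mu> x = tder \<nu> y + t_scale (fps_X ^ k) (tder \<mu> z + tder \<zeta> y)"
    unfolding x tder_simps(1,2)[of \<mu>] by (simp add: \<mu> tder_add tder_scale T.scale_right_distrib)
  then show ?thesis unfolding t_agree_iff by blast
qed

lemma t_agree_br:
  assumes "t_agree k x x'" "t_agree k y y'" shows "t_agree k (t_br x y) (t_br x' y')"
  using assms by (auto simp: t_agree_def t_br_def intro!: sum.cong)

lemma t_agree_scale: "t_agree k x y \<Longrightarrow> t_agree k (t_scale p x) (t_scale p y)"
  by (auto simp: t_agree_def t_scale_def intro!: sum.cong)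

lemma t_agree_sum: "(\<And>j. t_agree k (u j) (v j)) \<Longrightarrow> t_agree k (t_sum u) (t_sum v)"
  by (simp add: t_agree_def t_sum_def)

lemma t_agree_op_exp_tder:
  assumes \<mu>: "\<And>a. t_agree k (\<mu> a) (\<nu> a)"
  shows "t_agree k (op_exp (tder \<mu>) x) (op_exp (tder \<nu>) x)"
proof -
  have "t_agree k ((tder \<mu> ^^ j) x) ((tder \<nu> ^^ j) x)" for j
    by (induction j) (simp_all add: t_agree_tder[OF \<mu>] t_agree_def[of k x])
  then show ?thesis
    unfolding op_series_def by (intro t_agree_sum t_agree_scale)
qed

lemma t_agree_ad_tb:
  assumes "\<And>a. t_agree k (\<mu> a) (\<mu>' a)" "\<And>a. t_agree k (\<nu> a) (\<nu>' a)"
  shows "t_agree k (ad_tb \<mu> \<nu> a) (ad_tb \<mu>' \<nu>' a)"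
  using t_agree_br[OF assms(1)[of a] assms(2)[of a]] t_agree_tder[OF assms(1) assms(2)[of a]]
    t_agree_tder[OF assms(2) assms(1)[of a]]
  by (simp add: ad_tb_def t_agree_def)

lemma t_agree_op_series_fam_ad_tb:
  assumes "\<And>a. t_agree k (\<mu> a) (\<mu>' a)" "\<And>a. t_agree k (\<nu> a) (\<nu>' a)"
  shows "t_agree k (op_series_fam p (ad_tb \<mu>) \<nu> a) (op_series_fam p (ad_tb \<mu>') \<nu>' a)"
proof -
  have "t_agree k ((ad_tb \<mu> ^^ j) \<nu> a) ((ad_tb \<mu>' ^^ j) \<nu>' a)" for j a
    by (induction j arbitrary: a) (simp_all add: t_agree_ad_tb assms)
  then show ?thesis
    unfolding op_series_fam_def by (intro t_agree_sum t_agree_scale)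
qed

section \<open>Existence and uniqueness of the solution\<close>

lemma causal_unique_fixpoint:
  fixes I :: "('s \<Rightarrow> 's FL fps) \<Rightarrow> ('s \<Rightarrow> 's FL fps)"
  assumes I: "\<And>k \<mu> \<nu> a. (\<And>a. t_agree k (\<mu> a) (\<nu> a)) \<Longrightarrow> t_agree (Suc k) (I \<mu> a) (I \<nu> a)"
  shows "\<exists>!\<mu>. \<mu> = I \<mu>"
proof -
  have eqI: "\<mu> = \<nu>" if "\<And>k a. t_agree k (\<mu> a) (\<nu> a)" for \<mu> \<nu> :: "'s \<Rightarrow> 's FL fps"
    using that by (auto simp: fun_eq_iff fps_eq_iff t_agree_def)
  \<comment> \<open>Picard iteration from 0; from the n-th iterate on, the coefficients below t^n no
    longer change.\<close>
  define s where "s n = (I ^^ n) (\<lambda>_. 0)" for n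
  have s_Suc: "s (Suc n) = I (s n)" for n by (simp add: s_def)
  have s_agree: "t_agree n (s n a) (s m a)" if "n \<le> m" for n m a
    using that
  proof (induction n arbitrary: m a)
    case (Suc n)
    then obtain l where "m = Suc l" by (cases m) auto
    with Suc show ?case by (simp add: s_Suc I)
  qed (simp add: t_agree_def)
  \<comment> \<open>Iterate k + 1 is the first in which the coefficient of t^k is certain to be
    stable.\<close>
  define \<mu> where "\<mu> a = Abs_fps (\<lambda>k. s (Suc k) a $ k)" for a
  have \<mu>_agree: "t_agree n (\<mu> a) (s n a)" for n a
    using s_agree[of "Suc i" n a for i] by (simp add: t_agree_def \<mu>_def Suc_le_eq)
  have "t_agree n (\<mu> a) (I \<mu> a)" for n a
    using \<mu>_agree[of "Suc n" a] I[of n \<mu> "s n" a, OF \<mu>_agree] by (simp add: s_Suc t_agree_def)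
  then have "\<mu> = I \<mu>" by (rule eqI)
  moreover have "\<nu> = \<mu>" if "\<nu> = I \<nu>" for \<nu>
  proof (rule eqI)
    show "t_agree k (\<nu> a) (\<mu> a)" for k a
    proof (induction k arbitrary: a)
      case (Suc k)
      show ?case using I[of k \<nu> \<mu> a] Suc that \<open>\<mu> = I \<mu>\<close> by metis
    qed (simp add: t_agree_def)
  qed
  ultimately show ?thesis by blast
qed

text \<open>Integration from 0 turns the initial value problem into a fixpoint equation, and its
  index shift supplies the power of t that makes the equation causal.\<close>

lemma t_deriv_eq_iff:
  "x $ 0 = 0 \<and> t_deriv x = y \<longleftrightarrow>
    x = Abs_fps (\<lambda>k. if k = 0 then 0 else FL_scale (1 / of_nat k) (y $ (k - 1)))"
proof
  assume x: "x $ 0 = 0 \<and> t_deriv x = y"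
  show "x = Abs_fps (\<lambda>k. if k = 0 then 0 else FL_scale (1 / of_nat k) (y $ (k - 1)))"
  proof (rule fps_ext)
    fix n
    show "x $ n = Abs_fps (\<lambda>k. if k = 0 then 0 else FL_scale (1 / of_nat k) (y $ (k - 1))) $ n"
      using x by (cases n) (auto simp: t_deriv_nth simp del: of_nat_Suc of_nat_add)
  qed
next
  assume x: "x = Abs_fps (\<lambda>k. if k = 0 then 0 else FL_scale (1 / of_nat k) (y $ (k - 1)))"
  show "x $ 0 = 0 \<and> t_deriv x = y"
    by (simp add: x fps_eq_iff t_deriv_nth del: of_nat_Suc of_nat_add)
qed

lemma Lambda_ode_unique_solution:
  fixes lam :: "'s \<Rightarrow> 's FL"
  shows "\<exists>!\<Lambda>. solves_Lambda_ode lam \<Lambda>"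
proof -
  define G where "G \<Lambda> = op_series_fam (fps_X / (fps_exp 1 - 1)) (ad_tb \<Lambda>)
    (\<lambda>a. op_exp (tder \<Lambda>) (fps_const (lam a)))" for \<Lambda>
  define I where "I \<Lambda> a = Abs_fps (\<lambda>k. if k = 0 then 0 else FL_scale (1 / of_nat k) (G \<Lambda> a $ (k - 1)))"
    for \<Lambda> a
  have "solves_Lambda_ode lam \<Lambda> \<longleftrightarrow> \<Lambda> = I \<Lambda>" for \<Lambda>
    using t_deriv_eq_iff[of "\<Lambda> _" "G \<Lambda> _"]
    unfolding solves_Lambda_ode_def G_def[symmetric] fun_eq_iff I_def by blast
  moreover have "\<exists>!\<Lambda>. \<Lambda> = I \<Lambda>"
  proof (rule causal_unique_fixpoint)
    fix k a and \<mu> \<nu> :: "'s \<Rightarrow> 's FL fps"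
    assume "\<And>a. t_agree k (\<mu> a) (\<nu> a)"
    then have "t_agree k (G \<mu> a) (G \<nu> a)"
      unfolding G_def by (intro t_agree_op_series_fam_ad_tb t_agree_op_exp_tder)
    then show "t_agree (Suc k) (I \<mu> a) (I \<nu> a)"
      by (simp add: t_agree_def I_def)
  qed
  ultimately show ?thesis by simp
qed

section \<open>The linear equation satisfied by the image of a generator\<close>

lemma linear_ode_unique:
  assumes "x $ 0 = y $ 0" "t_deriv x = t_br (fps_const c) x" "t_deriv y = t_br (fps_const c) y"
  shows "x = y"
proof (rule fps_ext)
  \<comment> \<open>As c is constant in t, the equation is a one-term recursion for the
    coefficients.\<close>
  have step: "z $ Suc n = FL_scale (1 / of_nat (Suc n)) (FL_br c (z $ n))"
    if "t_deriv z = t_br (fps_const c) z" for z n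
  proof -
    have "FL_scale (1 / of_nat (Suc n)) (t_deriv z $ n) = z $ Suc n"
      by (simp add: t_deriv_nth del: of_nat_Suc of_nat_add)
    then show ?thesis by (simp add: that)
  qed
  show "x $ n = y $ n" for n
    by (induction n) (simp_all add: assms(1) step[OF assms(2)] step[OF assms(3)])
qed

text \<open>For initial values: at t = 0 only the term without \<open>T\<close> is left.\<close>

lemma op_series_nth_0:
  assumes T: "raises 1 T" and "\<And>x. T x $ 0 = 0"
  shows "op_series p T x $ 0 = FL_scale (p $ 0) (x $ 0)"
proof -
  have "((T ^^ Suc j) x) $ 0 = 0" for j by (simp add: assms(2))
  then have "t_sum (\<lambda>j. t_scale (fps_const (p $ Suc j)) ((T ^^ Suc j) x)) $ 0 = t_sum (\<lambda>j. 0) $ 0"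
    unfolding t_sum_def fps_nth_Abs_fps t_scale_const_nth by simp
  then show ?thesis
    unfolding op_series_def t_sum_shift[OF op_series_low_term0[OF T]] by simp
qed

lemma raises_br: "raises 1 (t_br z)"
  by (simp add: raises_def L.B_add_right t_br_scale_right low_br_right)

lemma exp_ad_ode:
  fixes c :: "'s FL" and x :: "'s FL"
  defines "y \<equiv> op_exp (t_br (t_scale fps_X (fps_const c))) (fps_const x)"
  shows "y $ 0 = x" "t_deriv y = t_br (fps_const c) y"
proof -
  let ?P = "t_br (t_scale fps_X (fps_const c))" and ?C = "fps_const c"
  show "y $ 0 = x"
    unfolding y_def by (subst op_series_nth_0[OF raises_br]) (simp_all add: t_br_scale_left t_scale_X_nth)
  have pow: "(?P ^^ j) (fps_const x) = t_scale (fps_X ^ j) ((t_br ?C ^^ j) (fps_const x))" for j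
    by (induction j) (simp_all add: t_br_scale_left t_br_scale_right mult.commute)
  have const: "t_deriv ((t_br ?C ^^ j) (fps_const x)) = 0" for j
    by (induction j) (simp_all add: t_deriv_br)
  let ?u = "\<lambda>j. t_scale (fps_const (1 / fact j)) ((?P ^^ j) (fps_const x))"
  have low_u: "low j (?u j)" for j by (rule op_series_low_term0[OF raises_br])
  have y: "y = t_sum ?u" by (simp add: y_def op_series_def)
  \<comment> \<open>Term j is t^j (ad c)^j x / j!, and differentiating term j + 1 gives
    [c, term j].\<close>
  have u: "t_deriv (?u (Suc j)) = t_br ?C (?u j)" for j
  proof -
    have "fps_const (1 / fact (Suc j)) * fps_deriv (fps_X ^ Suc j) = fps_const (1 / fact j) * (fps_X ^ j :: rat fps)"
      unfolding fps_deriv_power by (simp add: mult.assoc[symmetric] del: of_nat_Suc)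
    then show ?thesis
      unfolding pow by (simp add: t_deriv_scale t_deriv_br const t_br_scale_right)
  qed
  have "t_deriv y = t_sum (\<lambda>j. t_deriv (?u j))"
    unfolding y by (intro additive_t_sum t_deriv_add low_deriv low_u)
  also have "\<dots> = t_deriv (?u 0) + t_sum (\<lambda>j. t_deriv (?u (Suc j)))"
    by (rule t_sum_shift) (intro low_deriv low_u)
  also have "\<dots> = t_sum (\<lambda>j. t_br ?C (?u j))"
    unfolding u by simp
  also have "\<dots> = t_br ?C y"
    unfolding y using low_br[where m = 0]
    by (intro additive_t_sum[symmetric] L.B_add_right low_u) simp
  finally show "t_deriv y = t_br (fps_const c) y" .
qed

section \<open>Conjugation of d/dt by the exponential of the derivation\<close>

lemma todd_inverse:
  "Abs_fps (\<lambda>n. 1 / fact (Suc n)) * (fps_X / (fps_exp 1 - 1)) = (1 :: rat fps)"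
proof -
  let ?\<Psi> = "Abs_fps (\<lambda>n. 1 / fact (Suc n)) :: rat fps"
  \<comment> \<open>The divisor has constant term 0; with the factor \<open>fps_X\<close> cancelled,
    the remaining series (e^z - 1)/z has constant term 1 and is invertible.\<close>
  have e: "fps_exp 1 - 1 = fps_X * ?\<Psi>"
    by (rule fps_ext) (auto simp: gr0_conv_Suc split: nat.splits)
  have "?\<Psi> $ 0 \<noteq> 0" by simp
  then have "fps_X / (fps_X * ?\<Psi>) = 1 / ?\<Psi>"
    by (metis div_mult_mult1 fps_X_neq_zero mult.right_neutral)
  then show ?thesis
    unfolding e using \<open>?\<Psi> $ 0 \<noteq> 0\<close> by (simp add: fps_divide_unit inverse_mult_eq_1')
qed

lemma tder_op_series_fam:
  assumes T: "raises_fam T"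
  shows "tder (op_series_fam p T \<nu>) x = t_sum (\<lambda>j. t_scale (fps_const (p $ j)) (tder ((T ^^ j) \<nu>) x))"
proof -
  have low_tder: "low n (tder \<mu> x)" if "\<And>a. low n (\<mu> a)" for n \<mu>
    by (rule low_mono[OF tder_low_param[OF that]]) simp
  have "tder (\<lambda>a. t_sum (\<lambda>j. t_scale (fps_const (p $ j)) ((T ^^ j) \<nu> a))) x
      = t_sum (\<lambda>j. tder (\<lambda>a. t_scale (fps_const (p $ j)) ((T ^^ j) \<nu> a)) x)"
    by (rule additive_t_sum_fam[of "\<lambda>\<mu>. tder \<mu> x"])
      (simp_all add: tder_add raises_fam_low[OF T] low_tder)
  then show ?thesis by (simp add: op_series_fam_def tder_scale)
qed

lemma t_deriv_exp_tder:
  assumes "solves_Lambda_ode lam \<Lambda>"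
  shows "op_exp (tder \<Lambda>) (t_deriv (op_exp (\<lambda>x. - tder \<Lambda> x) x))
    = t_deriv x - tder (\<lambda>a. op_exp (tder \<Lambda>) (fps_const (lam a))) x"
proof -
  define \<nu> where "\<nu> = (\<lambda>a. t_deriv (\<Lambda> a))"
  define M where "M = (\<lambda>a. op_exp (tder \<Lambda>) (fps_const (lam a)))"
  let ?T = "ad_tb \<Lambda>" and ?q = "\<lambda>n. t_scale (fps_const (1 / fact n))"
  have "\<nu> = op_series_fam (fps_X / (fps_exp 1 - 1)) ?T M"
    using assms by (simp add: solves_Lambda_ode_def \<nu>_def M_def)
  \<comment> \<open>Applying (e^z - 1)/z at z = \<open>ad_tb \<Lambda>\<close> to both sides of the
    equation cancels the series on its right.\<close>
  then have M: "op_series_fam (Abs_fps (\<lambda>n. 1 / fact (Suc n))) ?T \<nu> = M"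
    by (simp only: op_series_fam_mult[OF raises_fam_ad_tb] todd_inverse op_series_fam_one)
  \<comment> \<open>The first commutator with d/dt is \<open>- tder \<nu>\<close>; each further one
    acts on the parameter as \<open>ad_tb \<Lambda>\<close>, by
    \<open>tder_commutator\<close>.\<close>
  have ad: "(op_ad (tder \<Lambda>) ^^ Suc n) t_deriv x = - tder ((?T ^^ n) \<nu>) x" for n x
  proof (induction n arbitrary: x)
    case 0
    show ?case using tder_t_deriv[of \<Lambda> x] by (simp add: op_ad_def \<nu>_def algebra_simps)
  next
    case (Suc n)
    have "(op_ad (tder \<Lambda>) ^^ Suc (Suc n)) t_deriv x
        = tder \<Lambda> ((op_ad (tder \<Lambda>) ^^ Suc n) t_deriv x) - (op_ad (tder \<Lambda>) ^^ Suc n) t_deriv (tder \<Lambda> x)"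
      by (simp add: op_ad_def)
    then show ?case
      unfolding Suc.IH by (simp add: tder_simps tder_commutator[symmetric])
  qed
  have low_ad: "low n (?q n ((op_ad (tder \<Lambda>) ^^ n) t_deriv x))" for n
  proof (cases n)
    case (Suc m)
    have "low (Suc m) (tder ((?T ^^ m) \<nu>) x)"
      using raises_fam_funpow(3)[OF raises_fam_ad_tb, of 0 \<nu> m] by (intro tder_low_param) simp
    then show ?thesis unfolding Suc ad by (intro low_scale low_uminus)
  qed simp
  have low_tder: "low n (?q (Suc n) (tder ((?T ^^ n) \<nu>) x))" for n
    using raises_fam_funpow(3)[OF raises_fam_ad_tb, of 0 \<nu> n]
    by (intro low_scale low_mono[OF tder_low_param]) auto
  have "op_exp (tder \<Lambda>) (t_deriv (op_exp (\<lambda>x. - tder \<Lambda> x) x))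
      = t_sum (\<lambda>n. ?q n ((op_ad (tder \<Lambda>) ^^ n) t_deriv x))"
    by (rule op_exp_conjugate[OF raises_tder raises_deriv])
  \<comment> \<open>The term n = 0 is d/dt itself. The shift turns 1/n! into 1/(n + 1)!, the
    coefficients of (e^z - 1)/z.\<close>
  also have "\<dots> = t_deriv x + t_sum (\<lambda>n. - ?q (Suc n) (tder ((?T ^^ n) \<nu>) x))"
    unfolding t_sum_shift[OF low_ad] ad by simp
  also have "t_sum (\<lambda>n. - ?q (Suc n) (tder ((?T ^^ n) \<nu>) x)) = - tder M x"
    unfolding M[symmetric] tder_op_series_fam[OF raises_fam_ad_tb] fps_nth_Abs_fps
    by (rule additive_t_sum[symmetric]) (simp_all add: low_uminus low_tder del: fact_Suc)
  finally show ?thesis by (simp add: M_def)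
qed

theorem proposition2p8:
  fixes lam :: "'s::finite \<Rightarrow> 's FL"
  shows "(\<exists>!\<Lambda>. solves_Lambda_ode lam \<Lambda>) \<and>
    (\<forall>\<Lambda>. solves_Lambda_ode lam \<Lambda> \<longrightarrow>
      conj_aut (\<lambda>a. t_scale fps_X (fps_const (lam a))) = op_exp (\<lambda>x. - tder \<Lambda> x))"
proof (intro conjI allI impI)
  show "\<exists>!\<Lambda>. solves_Lambda_ode lam \<Lambda>" by (rule Lambda_ode_unique_solution)
  fix \<Lambda> assume ode: "solves_Lambda_ode lam \<Lambda>"
  let ?N = "\<lambda>x. - tder \<Lambda> x"
  have N: "raises 1 ?N" by (intro raises_uminus raises_tder)
  have "cont_derivation ?N"
    by (intro cont_derivationI low_uminus tder_low_same)
      (simp_all add: tder_simps tder_br additive.minus[OF L.additive_B_left]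
        additive.minus[OF L.additive_B_right])
  then have aut: "cont_automorphism (op_exp ?N)" using N by (rule op_exp_automorphism)
  \<comment> \<open>Modulo t the family is zero. Writing zero as
    \<open>t_scale 0 (\<Lambda> a)\<close> lets \<open>tder_scale\<close> show that the derivation
    vanishes at t = 0.\<close>
  have "t_agree 1 (\<Lambda> a) (t_scale 0 (\<Lambda> a))" for a
    using ode by (simp add: solves_Lambda_ode_def t_agree_def)
  then have "t_agree 1 (tder \<Lambda> x) (tder (\<lambda>a. t_scale 0 (\<Lambda> a)) x)" for x
    by (intro t_agree_tder) (simp_all add: t_agree_def)
  then have D0: "tder \<Lambda> x $ 0 = 0" for x
    unfolding tder_scale by (simp add: t_agree_def)
  \<comment> \<open>Both curves start at the generator and solve y' =
    [\<open>lam a\<close>, y].\<close>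
  have gen: "op_exp ?N (t_gen a) = op_exp (t_br (t_scale fps_X (fps_const (lam a)))) (t_gen a)" for a
  proof (rule linear_ode_unique[where c = "lam a"])
    note exp_ode = exp_ad_ode[of "lam a" "FL_gen a", folded t_gen_def]
    show "t_deriv (op_exp (t_br (t_scale fps_X (fps_const (lam a)))) (t_gen a))
        = t_br (fps_const (lam a)) (op_exp (t_br (t_scale fps_X (fps_const (lam a)))) (t_gen a))"
      by (rule exp_ode(2))
    show "op_exp ?N (t_gen a) $ 0 = op_exp (t_br (t_scale fps_X (fps_const (lam a)))) (t_gen a) $ 0"
      unfolding exp_ode(1) by (subst op_series_nth_0[OF N]) (simp_all add: D0 t_gen_def)
    have inv: "op_exp ?N (op_exp (tder \<Lambda>) x) = x" for x
      using op_exp_inverse[OF N] by simp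
    have lin: "t_linear (op_exp ?N)"
      and br: "op_exp ?N (t_br x y) = t_br (op_exp ?N x) (op_exp ?N y)" for x y
      using aut by (simp_all add: cont_automorphism_def)
    have "t_deriv (op_exp ?N (t_gen a))
        = op_exp ?N (op_exp (tder \<Lambda>) (t_deriv (op_exp ?N (t_gen a))))"
      by (rule inv[symmetric])
    \<comment> \<open>The generator is constant in t, so the conjugated d/dt sends it to
      -[a, e^D(\<open>lam a\<close>)]; the automorphism e^(-D) carries this to
      -[e^(-D) a, \<open>lam a\<close>].\<close>
    also have "\<dots> = - t_br (op_exp ?N (t_gen a)) (fps_const (lam a))"
      unfolding t_deriv_exp_tder[OF ode] by (simp add: tder_gen t_linearD[OF lin] br inv)
    also have "\<dots> = t_br (fps_const (lam a)) (op_exp ?N (t_gen a))"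
      by (rule L.B_anti[symmetric])
    finally show "t_deriv (op_exp ?N (t_gen a)) = t_br (fps_const (lam a)) (op_exp ?N (t_gen a))" .
  qed
  show "conj_aut (\<lambda>a. t_scale fps_X (fps_const (lam a))) = op_exp ?N"
    unfolding conj_aut_def
  proof (rule the_equality)
    show "f = op_exp ?N"
      if "cont_automorphism f \<and> (\<forall>a. f (t_gen a) = op_exp (t_br (t_scale fps_X (fps_const (lam a)))) (t_gen a))"
      for f
      by (rule cont_automorphism_eqI) (use that aut gen in simp_all)
  qed (use aut gen in blast)
qed

end
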